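(* Let $k\geq 2$ be an integer and $P=(p_1,\dots,p_k)$ a probability distribution on $\{1,\dots,k\}$ with $p_i\neq 0$ for every $i$. Let $\chi^2_{k-1}$ denote a chi-squared random variable with $k-1$ degrees of freedom. Then for every real $m\geq 1$, \[ \lim_{n\to\infty}\mathbb{E}\big[(2nV_{n,k,P})^m\big]=\mathbb{E}\big[(\chi^2_{k-1})^m\big]=2^m\frac{\Gamma\big(m+\frac{k-1}{2}\big)}{\Gamma\big(\frac{k-1}{2}\big)}, \] \[ \lim_{n\to\infty}\mathbb{E}\big[(2nV_{n,k,P}-\mathbb{E}[2nV_{n,k,P}])^m\big]=\mathbb{E}\big[(\chi^2_{k-1}-\mathbb{E}[\chi^2_{k-1}])^m\big], \] and for every $s\in[0,1/2)$, \[ \lim_{n\to\infty}\mathbb{E}\big[\exp(s\cdot 2nV_{n,k,P})\big]=\mathbb{E}\big[\exp(s\chi^2_{k-1})\big]=(1-2s)^{-(k-1)/2}, \] \[ \lim_{n\to\infty}\mathbb{E}\big[\exp\big(s(2nV_{n,k,P}-\mathbb{E}[2nV_{n,k,P}])\big)\big]=\mathbb{E}\big[\exp\big(s(\chi^2_{k-1}-\mathbb{E}[\chi^2_{k-1}])\big)\big]=e^{-(k-1)s}(1-2s)^{-(k-1)/2}. \]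
   Context: For a positive integer $n$, $X=(X_1,\dots,X_k)$ is multinomially distributed with $n$ samples and probabilities $P$, and $V_{n,k,P}=D\big((X_1/n,\dots,X_k/n)\,\|\,(p_1,\dots,p_k)\big)$ where $D\big((q_i)_i\,\|\,(p_i)_i\big)=\sum_i q_i\log\frac{q_i}{p_i}$ is the Kullback--Leibler divergence (natural logarithm, convention $0\log(0/p)=0$).
   Formalization: The limit of the centered moments (second display) is stated for integers m ≥ 1 only, because the centered variables take negative values, whose m-th power is undefined over the reals for non-integer m; the raw moments are for every real m ≥ 1. *)

theory Defs
  imports "HOL-Probability.Probability"
begin

definition KL_div :: "nat \<Rightarrow> (nat \<Rightarrow> real) \<Rightarrow> (nat \<Rightarrow> real) \<Rightarrow> real" where
  "KL_div k q p = (\<Sum>i\<in>{1..k}. if q i = 0 then 0 else q i * ln (q i / p i))"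

definition mult_outcomes :: "nat \<Rightarrow> nat \<Rightarrow> (nat \<Rightarrow> nat) set" where
  "mult_outcomes n k = {x. (\<forall>i. i \<notin> {1..k} \<longrightarrow> x i = 0) \<and> (\<Sum>i\<in>{1..k}. x i) = n}"

definition mult_pmf :: "nat \<Rightarrow> nat \<Rightarrow> (nat \<Rightarrow> real) \<Rightarrow> (nat \<Rightarrow> nat) \<Rightarrow> real" where
  "mult_pmf n k p x = fact n / (\<Prod>i\<in>{1..k}. fact (x i)) * (\<Prod>i\<in>{1..k}. p i ^ x i)"

definition mult_expect :: "nat \<Rightarrow> nat \<Rightarrow> (nat \<Rightarrow> real) \<Rightarrow> ((nat \<Rightarrow> nat) \<Rightarrow> real) \<Rightarrow> real" where
  "mult_expect n k p f = (\<Sum>x\<in>mult_outcomes n k. mult_pmf n k p x * f x)"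

definition V_stat :: "nat \<Rightarrow> nat \<Rightarrow> (nat \<Rightarrow> real) \<Rightarrow> (nat \<Rightarrow> nat) \<Rightarrow> real" where
  "V_stat n k p x = KL_div k (\<lambda>i. real (x i) / real n) p"

definition chi_sq_density :: "nat \<Rightarrow> real \<Rightarrow> real" where
  "chi_sq_density \<nu> x = (if x > 0 then x powr (real \<nu> / 2 - 1) * exp (- x / 2)
       / (2 powr (real \<nu> / 2) * Gamma (real \<nu> / 2)) else 0)"

definition chi_sq :: "nat \<Rightarrow> real measure" where
  "chi_sq \<nu> = density lborel (\<lambda>x. ennreal (chi_sq_density \<nu> x))"

definition chi_sq_expect :: "nat \<Rightarrow> (real \<Rightarrow> real) \<Rightarrow> real" where
  "chi_sq_expect \<nu> f = (\<integral>x. f x \<partial>chi_sq \<nu>)"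

end

theory Submission
  imports Defs "HOL-Real_Asymp.Real_Asymp"
begin

text \<open>
  Given the last cell count \<open>x\<close>, the other cells are multinomial with \<open>n - x\<close> samples, and by the chain
  rule the divergence splits into a two-cell divergence and the divergence of the smaller
  multinomial. A two-cell Laplace limit, which is uniform enough to carry along a convergent
  factor \<open>a (n - x)\<close>, then gives by induction on \<open>k\<close> that the moment generating function of \<open>2 n V\<close>
  converges to \<open>(1 - 2 s) powr (- (k - 1) / 2)\<close> for every real \<open>s < 1 / 2\<close>, negative \<open>s\<close> included.
  Since \<open>2 n V \<ge> 0\<close>, the Weierstrass theorem in the variable \<open>exp (- y)\<close> upgrades this to the
  convergence of the expectation of every continuous function that is
  \<open>o(exp (s y))\<close> for some \<open>s < 1 / 2\<close>, in particular of all powers.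
\<close>

section \<open>Stirling weights and cell divergences\<close>

text \<open>Convergence of \<open>2 n V\<close> in distribution would not be enough: powers and
  exponentials are unbounded, so exponential moments must be controlled uniformly in
  \<open>n\<close> all the way up to \<open>s = 1 / 2\<close>. That critical value comes from an
  exact identity. Once every factorial is expressed through \<open>stirling_weight\<close>, the
  multinomial point mass is a ratio of Stirling weights times \<open>exp (- n V)\<close>, so tilting
  by \<open>exp (s * 2 n V)\<close> merely turns the exponent into \<open>- t n V\<close> with
  \<open>t = 1 - 2 s > 0\<close>. Near its minimum \<open>n V\<close> is a quadratic form, and every
  cell after the first contributes a Gaussian integral whose width scales like
  \<open>1 / sqrt t\<close>; hence \<open>k - 1\<close> factors. The delicate region is the
  boundary, where a cell is nearly empty and its Stirling weight is not small: there the large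
  deviation from the mean has to pay for it. Negative \<open>s\<close> enter because a polynomial in
  \<open>exp (- y)\<close> lowers the exponent by arbitrary integers.
  \<open>stirling_weight n\<close> itself is the probability that a Poisson variable of mean
  \<open>n\<close> equals \<open>n\<close>.\<close>

definition stirling_weight :: "nat \<Rightarrow> real" where
  "stirling_weight n = real n ^ n * exp (- real n) / fact n"

lemma stirling_weight_0 [simp]: "stirling_weight 0 = 1"
  by (simp add: stirling_weight_def)

lemma stirling_weight_pos: "stirling_weight n > 0"
  by (cases "n = 0") (auto simp: stirling_weight_def)

text \<open>The increments of the logarithm are \<open>(n + 1/2) * ln (1 + 1 / n) - 1\<close>, of
  order \<open>1 / n ^ 2\<close>, hence summable, and they telescope. The limit stays an anonymous
  constant until a total mass fixes it in \<open>two_cell_sum_limit\<close>.\<close>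

lemma stirling_weight_limit:
  obtains c where "c > 0" "(\<lambda>n. sqrt (real n) * stirling_weight n) \<longlonglongrightarrow> c"
proof -
  define l where "l n = ln (sqrt (real n) * stirling_weight n)" for n :: nat
  have l_eq: "l n = (real n + 1/2) * ln (real n) - real n - ln (fact n)" if "n > 0" for n
    using that unfolding l_def stirling_weight_def
    by (simp add: ln_mult ln_div ln_sqrt ln_realpow field_simps)
  have step: "l (Suc (Suc n)) - l (Suc n) = (real (Suc n) + 1/2) * ln (1 + 1 / real (Suc n)) - 1" for n
  proof -
    define N where "N = real (Suc n)"
    have N: "N > 0" "real (Suc (Suc n)) = N + 1"
      by (simp_all add: N_def)
    have "1 + 1 / N = (N + 1) / N"
      using N by (simp add: field_simps)
    then have log: "ln (1 + 1 / N) = ln (N + 1) - ln N"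
      using N by (simp add: ln_div)
    have "ln (fact (Suc (Suc n)) :: real) = ln ((N + 1) * fact (Suc n))"
      by (simp only: fact_Suc[of "Suc n"] N(2) of_nat_mult of_nat_fact)
    then have "ln (fact (Suc (Suc n)) :: real) = ln (N + 1) + ln (fact (Suc n))"
      using N by (simp add: ln_mult del: fact_Suc)
    then have e2: "l (Suc (Suc n)) = (N + 1 + 1/2) * ln (N + 1) - (N + 1) - (ln (N + 1) + ln (fact (Suc n)))"
      by (simp only: l_eq[OF zero_less_Suc] N(2))
    have e1: "l (Suc n) = (N + 1/2) * ln N - N - ln (fact (Suc n))"
      by (simp only: l_eq[OF zero_less_Suc] N_def)
    show ?thesis
      unfolding e1 e2 N_def[symmetric] log by (simp add: algebra_simps add_divide_distrib del: fact_Suc)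
  qed
  have "(\<lambda>n. (real (Suc n) + 1/2) * ln (1 + 1 / real (Suc n)) - 1) \<in> O(\<lambda>n. 1 / real n ^ 2)"
    by real_asymp
  moreover have "summable (\<lambda>n. norm (1 / real n ^ 2))"
    using inverse_power_summable[of 2, where 'a = real] by (simp add: field_simps)
  ultimately have "summable (\<lambda>n. l (Suc (Suc n)) - l (Suc n))"
    unfolding step by (rule summable_comparison_test_bigo[rotated])
  then have "convergent (\<lambda>n. \<Sum>i<n. l (Suc (Suc i)) - l (Suc i))"
    by (simp add: summable_iff_convergent)
  then have "convergent (\<lambda>n. l (Suc n) - l (Suc 0))"
    by (subst (asm) sum_lessThan_telescope)
  then have "convergent l"
    using convergent_diff_const_right_iff convergent_Suc_iff by blast
  then obtain L where "l \<longlonglongrightarrow> L"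
    by (auto simp: convergent_def)
  then have "(\<lambda>n. exp (l n)) \<longlonglongrightarrow> exp L"
    by (rule tendsto_exp)
  moreover have "eventually (\<lambda>n. exp (l n) = sqrt (real n) * stirling_weight n) sequentially"
    using eventually_gt_at_top[of 0] by eventually_elim (simp add: l_def stirling_weight_pos)
  ultimately show ?thesis
    by (intro that[of "exp L"]) (auto elim: Lim_transform_eventually)
qed

text \<open>Convergence to a positive limit bounds both the sequence and its reciprocal, giving
  constants valid for all \<open>n\<close> at once, as domination requires. The lower bound excludes
  \<open>n = 0\<close>, where the factor \<open>sqrt (real n)\<close> vanishes.\<close>

lemma stirling_weight_bounds:
  obtains C where "C > 0" "\<And>n. stirling_weight n \<le> C" "\<And>n. sqrt (real n) * stirling_weight n \<le> C"
    "\<And>n. n > 0 \<Longrightarrow> 1 \<le> C * (sqrt (real n) * stirling_weight n)"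
proof -
  obtain c where c: "c > 0" "(\<lambda>n. sqrt (real n) * stirling_weight n) \<longlonglongrightarrow> c"
    using stirling_weight_limit .
  obtain C1 where C1: "C1 > 0" "\<And>n. norm (sqrt (real n) * stirling_weight n) \<le> C1"
    using convergent_imp_Bseq[OF convergentI[OF c(2)]] by (auto simp: Bseq_def)
  have inv: "(\<lambda>n. inverse (sqrt (real n) * stirling_weight n)) \<longlonglongrightarrow> inverse c"
    using c by (intro tendsto_inverse) auto
  obtain C2 where C2: "C2 > 0" "\<And>n. norm (inverse (sqrt (real n) * stirling_weight n)) \<le> C2"
    using convergent_imp_Bseq[OF convergentI[OF inv]] by (auto simp: Bseq_def)
  define C where "C = 1 + C1 + C2"
  show ?thesis
  proof (rule that[of C])
    show "C > 0" using C1 C2 by (simp add: C_def)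
    show b: "sqrt (real n) * stirling_weight n \<le> C" for n
      using C1(2)[of n] C2(1) by (simp add: C_def)
    show "stirling_weight n \<le> C" for n
    proof (cases "n = 0")
      case True
      then show ?thesis using C1 C2 by (simp add: C_def)
    next
      case False
      then have "1 * stirling_weight n \<le> sqrt (real n) * stirling_weight n"
        using stirling_weight_pos[of n] by (intro mult_right_mono) auto
      then show ?thesis using b[of n] by simp
    qed
    show "1 \<le> C * (sqrt (real n) * stirling_weight n)" if "n > 0" for n
    proof -
      have pos: "sqrt (real n) * stirling_weight n > 0"
        using that stirling_weight_pos by simp
      have "inverse (sqrt (real n) * stirling_weight n) \<le> C"
        using C2(2)[of n] C1(1) by (simp add: C_def)
      then show ?thesis using pos by (simp add: field_simps)
    qed
  qed
qed

text \<open>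
  With \<open>m = n p\<^sub>i\<close> the terms \<open>cell_div x\<^sub>i m\<close> add up to \<open>n V\<close>.
\<close>

definition cell_div :: "nat \<Rightarrow> real \<Rightarrow> real" where
  "cell_div x m = (if x = 0 then 0 else real x * ln (real x / m))"

text \<open>
  The elementary estimate \<open>x ln (x / m) \<ge> x - m + (sqrt x - sqrt m)\<^sup>2\<close> replaces Pinsker's inequality;
  the linear terms cancel when summed over the cells.
\<close>

lemma cell_div_lower_bound:
  assumes "m \<ge> 0" "m = 0 \<Longrightarrow> x = 0" "m \<le> n" "real x \<le> n" "n > 0"
  shows "cell_div x m \<ge> real x - m + (real x - m)\<^sup>2 / (4 * n)"
proof -
  define a b where "a = sqrt (real x)" and "b = sqrt m"
  have ab: "real x = a\<^sup>2" "m = b\<^sup>2" "a \<ge> 0" "b \<ge> 0"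
    using assms by (auto simp: a_def b_def)
  \<comment> \<open>Since \<open>x - m = (a - b) * (a + b)\<close>, it suffices that
    \<open>(a + b)^2 <= 4 * n\<close>; this is the origin of the constant 4.\<close>
  have "(a - b)\<^sup>2 \<ge> (real x - m)\<^sup>2 / (4 * n)"
  proof -
    have "(a + b)\<^sup>2 \<le> 2 * a\<^sup>2 + 2 * b\<^sup>2"
      using sum_squares_bound[of a b] by (simp add: power2_sum)
    also have "\<dots> \<le> 4 * n"
      using assms ab by simp
    finally have "(a - b)\<^sup>2 * (a + b)\<^sup>2 \<le> (a - b)\<^sup>2 * (4 * n)"
      by (intro mult_left_mono) auto
    moreover have "(a - b)\<^sup>2 * (a + b)\<^sup>2 = (real x - m)\<^sup>2"
      unfolding ab by (simp add: power2_eq_square algebra_simps)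
    ultimately show ?thesis
      using assms by (simp add: field_simps)
  qed
  moreover have "cell_div x m \<ge> real x - m + (a - b)\<^sup>2"
  proof (cases "x = 0")
    case True
    then show ?thesis using ab by (simp add: cell_div_def)
  next
    case False
    then have "m > 0"
      using assms(1,2) by (cases "m = 0") auto
    with False have pos: "a > 0" "b > 0"
      by (simp_all add: a_def b_def)
    \<comment> \<open>Applying the tangent bound to the ratio of square roots, and then multiplying
      by \<open>- 2 * a^2\<close>, produces the square \<open>(a - b)^2\<close>; applied to
      \<open>m / x\<close> directly it would give only the linear part.\<close>
    have "ln (b / a) \<le> b / a - 1"
      using pos by (intro ln_le_minus_one) auto
    then have "a\<^sup>2 * (2 * (1 - b / a)) \<le> a\<^sup>2 * (- 2 * ln (b / a))"
      by (intro mult_left_mono) auto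
    moreover have "a\<^sup>2 * (2 * (1 - b / a)) = real x - m + (a - b)\<^sup>2"
      unfolding ab using pos by (simp add: field_simps power2_eq_square)
    moreover have "ln (real x / m) = - 2 * ln (b / a)"
      using pos unfolding ab by (simp add: ln_div ln_realpow)
    then have "cell_div x m = a\<^sup>2 * (- 2 * ln (b / a))"
      using False by (simp only: cell_div_def if_False ab(1)[symmetric])
    ultimately show ?thesis
      by linarith
  qed
  ultimately show ?thesis by linarith
qed

text \<open>Second-order Taylor expansion in the relative deviation \<open>y = (x - m) / m\<close>
  with \<open>m = n * p\<close>: the expression equals \<open>m * y^2 * \<phi> y\<close>, where
  \<open>m * y^2 = w^2 / p\<close> converges and \<open>y\<close> tends to 0.\<close>

lemma cell_div_limit:
  fixes x :: "nat \<Rightarrow> nat"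
  assumes "p > 0" and lim: "(\<lambda>n. (real (x n) - real n * p) / sqrt (real n)) \<longlonglongrightarrow> v"
  shows "(\<lambda>n. cell_div (x n) (real n * p) - (real (x n) - real n * p)) \<longlonglongrightarrow> v\<^sup>2 / (2 * p)"
proof -
  define w where "w n = (real (x n) - real n * p) / sqrt (real n)" for n
  define y where "y n = w n * (1 / (p * sqrt (real n)))" for n
  \<comment> \<open>The value 1/2 removes the singularity at 0, since
    \<open>(1 + z) * ln (1 + z) = z + z^2 / 2 + ...\<close>. Continuity at 0 then also covers those
    \<open>n\<close> with \<open>y n = 0\<close>.\<close>
  define \<phi> where "\<phi> z = (if z = 0 then 1/2 else ((1 + z) * ln (1 + z) - z) / z\<^sup>2)" for z :: real
  have w: "w \<longlonglongrightarrow> v"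
    unfolding w_def by (rule lim)
  have "(\<lambda>n. 1 / (p * sqrt (real n))) \<longlonglongrightarrow> 0"
    using \<open>p > 0\<close> by real_asymp
  from tendsto_mult[OF w this] have y: "y \<longlonglongrightarrow> 0"
    unfolding y_def by simp
  have "((\<lambda>z::real. ((1 + z) * ln (1 + z) - z) / z\<^sup>2) \<longlongrightarrow> 1/2) (at 0)"
    by real_asymp
  then have "(\<phi> \<longlongrightarrow> \<phi> 0) (at 0)"
    by (auto simp: \<phi>_def eventually_at_filter elim!: Lim_transform_eventually)
  then have "isCont \<phi> 0"
    by (simp add: isCont_def)
  from isCont_tendsto_compose[OF this y] have "(\<lambda>n. \<phi> (y n)) \<longlonglongrightarrow> 1/2"
    by (simp add: \<phi>_def)
  then have "(\<lambda>n. (w n)\<^sup>2 / p * \<phi> (y n)) \<longlonglongrightarrow> v\<^sup>2 / p * (1/2)"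
    using \<open>p > 0\<close> by (intro tendsto_intros w) auto
  moreover have "eventually (\<lambda>n. (w n)\<^sup>2 / p * \<phi> (y n)
      = cell_div (x n) (real n * p) - (real (x n) - real n * p)) sequentially"
  proof -
    have "eventually (\<lambda>n. y n > -1) sequentially"
      using y by (rule order_tendstoD) simp
    then show ?thesis
      using eventually_gt_at_top[of 0]
    proof eventually_elim
      case (elim n)
      define m where "m = real n * p"
      have m: "m > 0" using elim \<open>p > 0\<close> by (simp add: m_def)
      have s: "sqrt (real n) * sqrt (real n) = real n" "sqrt (real n) > 0"
        using elim by auto
      have y_eq: "y n = (real (x n) - m) / m"
        using s \<open>p > 0\<close> by (simp add: y_def w_def m_def field_simps)
      have x_eq: "real (x n) = m * (1 + y n)"
        using m by (simp add: y_eq field_simps)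
      have w_eq: "(w n)\<^sup>2 / p = m * (y n)\<^sup>2"
        using s \<open>p > 0\<close> by (simp add: y_def m_def power2_eq_square field_simps)
      have xpos: "x n > 0"
        using elim(1) y_eq m by (cases "x n = 0") auto
      have "real (x n) / m = 1 + y n"
        using m by (simp add: x_eq)
      then have "cell_div (x n) m = m * (1 + y n) * ln (1 + y n)"
        using xpos by (simp only: cell_div_def x_eq split: if_split) simp
      then have "cell_div (x n) m - (real (x n) - m) = m * ((1 + y n) * ln (1 + y n) - y n)"
        unfolding x_eq by (simp add: algebra_simps)
      also have "\<dots> = m * (y n)\<^sup>2 * \<phi> (y n)"
        by (simp add: \<phi>_def)
      finally show ?case
        by (simp add: w_eq m_def)
    qed
  qed
  ultimately show ?thesis
    by (simp only: mult_1_right times_divide_times_eq mult.commute[of 2 p] Lim_transform_eventually)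
qed

section \<open>The two-cell limit\<close>

lemma gaussian_has_bochner_integral:
  fixes a :: real
  assumes "a > 0"
  shows "has_bochner_integral lborel (\<lambda>u. exp (- a * u\<^sup>2)) (sqrt (pi / a))"
proof -
  define \<sigma> where "\<sigma> = sqrt (1 / (2 * a))"
  have \<sigma>: "\<sigma> > 0" "\<sigma>\<^sup>2 = 1 / (2 * a)"
    using assms by (auto simp: \<sigma>_def)
  have "has_bochner_integral lborel (normal_density 0 \<sigma>) 1"
    using \<sigma> by (simp add: has_bochner_integral_iff)
  then have "has_bochner_integral lborel (\<lambda>u. sqrt (pi / a) * normal_density 0 \<sigma> u) (sqrt (pi / a) * 1)"
    by (rule has_bochner_integral_mult_right)
  moreover have "sqrt (pi / a) * normal_density 0 \<sigma> u = exp (- a * u\<^sup>2)" for u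
    using assms by (simp add: normal_density_def \<sigma>)
  ultimately show ?thesis by simp
qed

lemma integrable_quadratic_gaussian:
  fixes a :: real
  assumes "a > 0"
  shows "integrable lborel (\<lambda>u. (2 + \<bar>u\<bar>)\<^sup>2 * exp (- a * u\<^sup>2))"
proof (rule Bochner_Integration.integrable_bound)
  show "integrable lborel (\<lambda>u. (8 + 4 / a) * exp (- (a / 2) * u\<^sup>2))"
    using gaussian_has_bochner_integral[of "a / 2"] assms
    by (intro integrable_mult_right) (auto simp: has_bochner_integral_iff)
  show "AE u in lborel. norm ((2 + \<bar>u\<bar>)\<^sup>2 * exp (- a * u\<^sup>2)) \<le> norm ((8 + 4 / a) * exp (- (a / 2) * u\<^sup>2))"
  proof (rule AE_I2)
    fix u :: real
    have "(2 + \<bar>u\<bar>)\<^sup>2 \<le> 8 + 2 * u\<^sup>2"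
      using sum_squares_bound[of 2 "\<bar>u\<bar>"] by (simp add: power2_sum)
    \<comment> \<open>Half of the Gaussian decay is spent on the polynomial. The constant makes
      \<open>(8 + 4 / a) * (1 + a / 2 * u^2)\<close> cover both \<open>8\<close> and
      \<open>2 * u^2\<close>.\<close>
    also have "\<dots> \<le> (8 + 4 / a) * exp (a / 2 * u\<^sup>2)"
    proof -
      have "1 + a / 2 * u\<^sup>2 \<le> exp (a / 2 * u\<^sup>2)"
        by (rule exp_ge_add_one_self)
      then have "(8 + 4 / a) * (1 + a / 2 * u\<^sup>2) \<le> (8 + 4 / a) * exp (a / 2 * u\<^sup>2)"
        using assms by (intro mult_left_mono) auto
      moreover have "(8 + 4 / a) * (1 + a / 2 * u\<^sup>2) = 8 + 2 * u\<^sup>2 + (4 / a + 4 * a * u\<^sup>2)"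
        using assms by (simp add: field_simps)
      moreover have "4 / a + 4 * a * u\<^sup>2 \<ge> 0"
        using assms by simp
      ultimately show ?thesis by linarith
    qed
    finally have "(2 + \<bar>u\<bar>)\<^sup>2 * exp (- a * u\<^sup>2) \<le> (8 + 4 / a) * exp (a / 2 * u\<^sup>2) * exp (- a * u\<^sup>2)"
      by (intro mult_right_mono) auto
    also have "\<dots> = (8 + 4 / a) * exp (- (a / 2) * u\<^sup>2)"
      by (simp add: mult.assoc flip: exp_add)
    finally show "norm ((2 + \<bar>u\<bar>)\<^sup>2 * exp (- a * u\<^sup>2)) \<le> norm ((8 + 4 / a) * exp (- (a / 2) * u\<^sup>2))"
      using assms by simp
  qed
qed simp

text \<open>If \<open>x >= n * p / 2\<close>, then \<open>sqrt n\<close> is comparable to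
  \<open>sqrt x\<close> and the product is bounded. For smaller \<open>x\<close> it can grow like
  \<open>sqrt n\<close> (at \<open>x = 0\<close> the weight is 1), but then the standardized
  deviation is itself at least \<open>sqrt n * p / 2\<close>. The linear factor on the right covers
  both regimes.\<close>

lemma scaled_stirling_weight_bound:
  assumes "p > 0"
  obtains K where "K > 0" "\<And>n x. sqrt (real n) * stirling_weight x
    \<le> K * (1 + \<bar>real x - real n * p\<bar> / sqrt (real n))"
proof -
  obtain C where C: "C > 0" "\<And>n. stirling_weight n \<le> C" "\<And>n. sqrt (real n) * stirling_weight n \<le> C"
    by (rule stirling_weight_bounds) blast
  define K where "K = C * sqrt (2 / p) + 2 * C / p"
  have K: "K > 0" "C * sqrt (2 / p) \<le> K" "2 * C / p \<le> K"
    using C(1) assms by (auto simp: K_def intro!: add_pos_pos)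
  show ?thesis
  proof (rule that[of K])
    fix n x :: nat
    define v where "v = \<bar>real x - real n * p\<bar> / sqrt (real n)"
    have v: "v \<ge> 0" by (simp add: v_def)
    show "sqrt (real n) * stirling_weight x \<le> K * (1 + \<bar>real x - real n * p\<bar> / sqrt (real n))"
    proof (cases "n = 0")
      case True
      then show ?thesis using K by simp
    next
      case False
      then have s: "sqrt (real n) > 0" "sqrt (real n) * sqrt (real n) = real n" by auto
      have "sqrt (real n) * stirling_weight x \<le> K * (1 + v)"
      proof (cases "real x \<ge> real n * p / 2")
        case True
        then have "sqrt (real n) \<le> sqrt (2 / p) * sqrt (real x)"
          unfolding real_sqrt_mult[symmetric] using assms
          by (intro real_sqrt_le_mono) (simp add: field_simps)
        then have "sqrt (real n) * stirling_weight x \<le> sqrt (2 / p) * sqrt (real x) * stirling_weight x"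
          using stirling_weight_pos[of x] by (intro mult_right_mono) auto
        also have "\<dots> \<le> sqrt (2 / p) * C"
          using C(3)[of x] assms by (simp add: mult.assoc mult_left_mono)
        also have "\<dots> \<le> K * 1"
          using K by (simp add: mult.commute)
        also have "\<dots> \<le> K * (1 + v)"
          using K v by (intro mult_left_mono) auto
        finally show ?thesis .
      next
        case False
        then have "real n * p / 2 \<le> \<bar>real x - real n * p\<bar>"
          by linarith
        then have "sqrt (real n) * p / 2 \<le> v"
          unfolding v_def using s by (simp add: field_simps)
        then have "sqrt (real n) \<le> 2 / p * v"
          using assms by (simp add: field_simps)
        then have "sqrt (real n) * stirling_weight x \<le> (2 / p * v) * C"
          using C(1) C(2)[of x] stirling_weight_pos[of x] v assms by (intro mult_mono) auto
        also have "\<dots> = 2 * C / p * v" by simp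
        also have "\<dots> \<le> K * v"
          using K v by (intro mult_right_mono) auto
        also have "\<dots> \<le> K * (1 + v)"
          using K by simp
        finally show ?thesis .
      qed
      then show ?thesis by (simp add: v_def)
    qed
  qed (use K in auto)
qed

text \<open>For \<open>t = 1\<close> and \<open>x <= n\<close> this is the binomial point mass at
  \<open>x\<close>; a general \<open>t\<close> rescales only the divergence in the exponent.\<close>

definition two_cell_term :: "real \<Rightarrow> real \<Rightarrow> nat \<Rightarrow> nat \<Rightarrow> real" where
  "two_cell_term p t n x = stirling_weight x * stirling_weight (n - x) / stirling_weight n
     * exp (- t * (cell_div x (real n * p) + cell_div (n - x) (real n * (1 - p))))"

lemma two_cell_term_nonneg: "two_cell_term p t n x \<ge> 0"
  by (simp add: two_cell_term_def stirling_weight_pos less_imp_le)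

text \<open>The two cells deviate by opposite amounts, so the linear terms of
  \<open>cell_div_lower_bound\<close> cancel and the two quadratic terms add up.\<close>

lemma two_cell_div_lower_bound:
  assumes "0 < p" "p < 1" "x \<le> n" "n > 0"
  shows "cell_div x (real n * p) + cell_div (n - x) (real n * (1 - p))
    \<ge> ((real x - real n * p) / sqrt (real n))\<^sup>2 / 2"
proof -
  have "cell_div x (real n * p) \<ge> real x - real n * p + (real x - real n * p)\<^sup>2 / (4 * real n)"
    using assms by (intro cell_div_lower_bound) (auto simp: mult_le_cancel_left1)
  moreover have "cell_div (n - x) (real n * (1 - p)) \<ge> real (n - x) - real n * (1 - p)
      + (real (n - x) - real n * (1 - p))\<^sup>2 / (4 * real n)"
    using assms by (intro cell_div_lower_bound) (auto simp: mult_le_cancel_left1)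
  moreover have "real (n - x) - real n * (1 - p) = - (real x - real n * p)"
    using assms by (simp add: of_nat_diff algebra_simps)
  moreover have "(- (real x - real n * p))\<^sup>2 = (real x - real n * p)\<^sup>2"
    by (rule power2_minus)
  moreover have "((real x - real n * p) / sqrt (real n))\<^sup>2 / 2
    = (real x - real n * p)\<^sup>2 / (4 * real n) + (real x - real n * p)\<^sup>2 / (4 * real n)"
    by (simp add: power_divide)
  ultimately show ?thesis by simp
qed

text \<open>The factor \<open>sqrt n\<close> undoes the lattice spacing \<open>1 / sqrt n\<close> of
  the standardized variable. Each numerator weight costs one linear factor, hence the square; the
  denominator is controlled by the reciprocal bound.\<close>

lemma two_cell_term_bound:
  assumes "0 < p" "p < 1" "t > 0"
  obtains K where "K > 0" "\<And>n x. n > 0 \<Longrightarrow> x \<le> n \<Longrightarrow> sqrt (real n) * two_cell_term p t n x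
    \<le> K * (1 + \<bar>real x - real n * p\<bar> / sqrt (real n))\<^sup>2 * exp (- t / 2 * ((real x - real n * p) / sqrt (real n))\<^sup>2)"
proof -
  obtain C where C: "C > 0" "\<And>n. n > 0 \<Longrightarrow> 1 \<le> C * (sqrt (real n) * stirling_weight n)"
    by (rule stirling_weight_bounds) blast
  obtain K1 where K1: "K1 > 0" "\<And>n x. sqrt (real n) * stirling_weight x
    \<le> K1 * (1 + \<bar>real x - real n * p\<bar> / sqrt (real n))"
    using scaled_stirling_weight_bound[OF assms(1)] by metis
  obtain K2 where K2: "K2 > 0" "\<And>n x. sqrt (real n) * stirling_weight x
    \<le> K2 * (1 + \<bar>real x - real n * (1 - p)\<bar> / sqrt (real n))"
    using scaled_stirling_weight_bound[of "1 - p"] assms by (metis diff_gt_0_iff_gt)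
  show ?thesis
  proof (rule that[of "K1 * K2 * C"])
    fix n x :: nat
    assume n: "n > 0" and x: "x \<le> n"
    define v where "v = \<bar>real x - real n * p\<bar> / sqrt (real n)"
    have v: "v \<ge> 0" "((real x - real n * p) / sqrt (real n))\<^sup>2 = v\<^sup>2"
      by (auto simp: v_def power_divide)
    have s: "sqrt (real n) > 0" "sqrt (real n) * sqrt (real n) = real n"
      using n by auto
    have w: "stirling_weight n > 0" "stirling_weight x > 0" "stirling_weight (n - x) > 0"
      by (rule stirling_weight_pos)+
    have "\<bar>real (n - x) - real n * (1 - p)\<bar> = \<bar>real x - real n * p\<bar>"
      using x by (simp add: of_nat_diff algebra_simps)
    then have b2: "sqrt (real n) * stirling_weight (n - x) \<le> K2 * (1 + v)"
      using K2(2)[of n "n - x"] by (simp add: v_def)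
    have b1: "sqrt (real n) * stirling_weight x \<le> K1 * (1 + v)"
      using K1(2)[of n x] by (simp add: v_def)
    have b3: "1 / (sqrt (real n) * stirling_weight n) \<le> C"
      using C(2)[OF n] w s by (simp add: field_simps)
    have "sqrt (real n) * (stirling_weight x * stirling_weight (n - x) / stirling_weight n)
        = (sqrt (real n) * stirling_weight x) * (sqrt (real n) * stirling_weight (n - x))
          * (1 / (sqrt (real n) * stirling_weight n))"
      using s w by (simp add: field_simps)
    also have "\<dots> \<le> (K1 * (1 + v)) * (K2 * (1 + v)) * C"
      using w s K1(1) K2(1) C(1) v(1) by (intro mult_mono[OF mult_mono[OF b1 b2] b3]) auto
    also have "\<dots> = K1 * K2 * C * (1 + v)\<^sup>2"
      by (simp add: power2_eq_square)
    finally have b: "sqrt (real n) * (stirling_weight x * stirling_weight (n - x) / stirling_weight n)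
        \<le> K1 * K2 * C * (1 + v)\<^sup>2" .
    have "v\<^sup>2 / 2 \<le> cell_div x (real n * p) + cell_div (n - x) (real n * (1 - p))"
      using two_cell_div_lower_bound[OF assms(1,2) x n] v by simp
    then have "t * (v\<^sup>2 / 2) \<le> t * (cell_div x (real n * p) + cell_div (n - x) (real n * (1 - p)))"
      using assms by (intro mult_left_mono) auto
    then have e: "exp (- t * (cell_div x (real n * p) + cell_div (n - x) (real n * (1 - p)))) \<le> exp (- t / 2 * v\<^sup>2)"
      by simp
    have "sqrt (real n) * two_cell_term p t n x \<le> K1 * K2 * C * (1 + v)\<^sup>2 * exp (- t / 2 * v\<^sup>2)"
      unfolding two_cell_term_def mult.assoc[of "sqrt (real n)", symmetric]
      using K1(1) K2(1) C(1) w by (intro mult_mono[OF b e]) auto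
    then show "sqrt (real n) * two_cell_term p t n x
      \<le> K1 * K2 * C * (1 + \<bar>real x - real n * p\<bar> / sqrt (real n))\<^sup>2
        * exp (- t / 2 * ((real x - real n * p) / sqrt (real n))\<^sup>2)"
      by (simp only: v v_def[symmetric])
  qed (use K1 K2 C in auto)
qed

text \<open>A local limit theorem along lattice points whose standardized position converges. The
  second conclusion makes a factor \<open>a (n - x n)\<close> converge to the limit of
  \<open>a\<close>.\<close>

lemma two_cell_term_limit:
  fixes x :: "nat \<Rightarrow> nat"
  assumes p: "0 < p" "p < 1" and x: "\<And>n. n > 0 \<Longrightarrow> x n \<le> n"
    and lim: "(\<lambda>n. (real (x n) - real n * p) / sqrt (real n)) \<longlonglongrightarrow> v"
    and c: "c > 0" "(\<lambda>n. sqrt (real n) * stirling_weight n) \<longlonglongrightarrow> c"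
  shows "(\<lambda>n. sqrt (real n) * two_cell_term p t n (x n))
    \<longlonglongrightarrow> c / sqrt (p * (1 - p)) * exp (- (t / (2 * p * (1 - p))) * v\<^sup>2)"
    and "filterlim (\<lambda>n. n - x n) at_top sequentially"
proof -
  \<comment> \<open>Stated for a generic cell, because it serves both \<open>x n\<close> with
    \<open>p\<close> and \<open>n - x n\<close> with \<open>1 - p\<close>. Since
    \<open>y n / n\<close> tends to \<open>q > 0\<close>, \<open>sqrt n\<close> may be traded for
    \<open>sqrt (y n)\<close>.\<close>
  have weight: "(\<lambda>n. sqrt (real n) * stirling_weight (y n)) \<longlonglongrightarrow> c / sqrt q"
    and inf: "filterlim y at_top sequentially"
    if q: "q > 0" and ylim: "(\<lambda>n. (real (y n) - real n * q) / sqrt (real n)) \<longlonglongrightarrow> w" for y :: "nat \<Rightarrow> nat" and q w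
  proof -
    have "(\<lambda>n. 1 / sqrt (real n)) \<longlonglongrightarrow> 0"
      by real_asymp
    from tendsto_add[OF tendsto_mult[OF ylim this] tendsto_const[of q]]
    have "(\<lambda>n. (real (y n) - real n * q) / sqrt (real n) * (1 / sqrt (real n)) + q) \<longlonglongrightarrow> q"
      by simp
    moreover have "eventually (\<lambda>n. (real (y n) - real n * q) / sqrt (real n) * (1 / sqrt (real n)) + q
        = real (y n) / real n) sequentially"
      using eventually_gt_at_top[of 0] by eventually_elim (simp add: field_simps)
    ultimately have ratio: "(\<lambda>n. real (y n) / real n) \<longlonglongrightarrow> q"
      by (rule Lim_transform_eventually)
    have "filterlim (\<lambda>n. real (y n) / real n * real n) at_top sequentially"
      using ratio q by (rule filterlim_tendsto_pos_mult_at_top) (rule filterlim_real_sequentially)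
    moreover have "eventually (\<lambda>n. real (y n) / real n * real n = real (y n)) sequentially"
      using eventually_gt_at_top[of 0] by eventually_elim simp
    ultimately have "filterlim (\<lambda>n. real (y n)) at_top sequentially"
      using filterlim_cong[OF refl refl] by fast
    then show inf: "filterlim y at_top sequentially"
      by (simp add: filterlim_sequentially_iff_filterlim_real)
    have "(\<lambda>n. sqrt (real (y n)) * stirling_weight (y n) / sqrt (real (y n) / real n)) \<longlonglongrightarrow> c / sqrt q"
      using q by (intro tendsto_intros filterlim_compose[OF c(2) inf] ratio) auto
    moreover have "eventually (\<lambda>n. y n > 0) sequentially"
      using filterlim_at_top[THEN iffD1, OF inf, rule_format, of 1] by eventually_elim simp
    then have "eventually (\<lambda>n. sqrt (real (y n)) * stirling_weight (y n) / sqrt (real (y n) / real n)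
        = sqrt (real n) * stirling_weight (y n)) sequentially"
      by eventually_elim (simp add: real_sqrt_divide)
    ultimately show "(\<lambda>n. sqrt (real n) * stirling_weight (y n)) \<longlonglongrightarrow> c / sqrt q"
      by (rule Lim_transform_eventually)
  qed
  have "(\<lambda>n. - ((real (x n) - real n * p) / sqrt (real n))) \<longlonglongrightarrow> - v"
    using lim by (rule tendsto_minus)
  moreover have ev: "eventually (\<lambda>n. real (n - x n) - real n * (1 - p) = - (real (x n) - real n * p)) sequentially"
    using eventually_gt_at_top[of 0] by eventually_elim (simp add: x of_nat_diff algebra_simps)
  then have "eventually (\<lambda>n. - ((real (x n) - real n * p) / sqrt (real n))
      = (real (n - x n) - real n * (1 - p)) / sqrt (real n)) sequentially"
    by eventually_elim (simp only: minus_divide_left)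
  ultimately have lim': "(\<lambda>n. (real (n - x n) - real n * (1 - p)) / sqrt (real n)) \<longlonglongrightarrow> - v"
    by (rule Lim_transform_eventually)
  have q: "1 - p > 0" using p by simp
  show "filterlim (\<lambda>n. n - x n) at_top sequentially"
    by (rule inf[OF q lim'])
  have "(\<lambda>n. (cell_div (x n) (real n * p) - (real (x n) - real n * p))
      + (cell_div (n - x n) (real n * (1 - p)) - (real (n - x n) - real n * (1 - p))))
      \<longlonglongrightarrow> v\<^sup>2 / (2 * p) + (- v)\<^sup>2 / (2 * (1 - p))"
    using p q by (intro tendsto_add cell_div_limit lim lim')
  moreover have "v\<^sup>2 / (2 * p) + (- v)\<^sup>2 / (2 * (1 - p)) = v\<^sup>2 / (2 * p * (1 - p))"
    using p by (simp add: field_simps)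
  moreover have "eventually (\<lambda>n. (cell_div (x n) (real n * p) - (real (x n) - real n * p))
      + (cell_div (n - x n) (real n * (1 - p)) - (real (n - x n) - real n * (1 - p)))
      = cell_div (x n) (real n * p) + cell_div (n - x n) (real n * (1 - p))) sequentially"
    using ev by eventually_elim simp
  ultimately have "(\<lambda>n. cell_div (x n) (real n * p) + cell_div (n - x n) (real n * (1 - p)))
      \<longlonglongrightarrow> v\<^sup>2 / (2 * p * (1 - p))"
    by (simp add: Lim_transform_eventually)
  then have "(\<lambda>n. (sqrt (real n) * stirling_weight (x n)) * (sqrt (real n) * stirling_weight (n - x n))
       / (sqrt (real n) * stirling_weight n)
       * exp (- t * (cell_div (x n) (real n * p) + cell_div (n - x n) (real n * (1 - p)))))
     \<longlonglongrightarrow> (c / sqrt p) * (c / sqrt (1 - p)) / c * exp (- t * (v\<^sup>2 / (2 * p * (1 - p))))"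
    using c by (intro tendsto_intros weight[OF p(1) lim] weight[OF q lim']) auto
  moreover have "(c / sqrt p) * (c / sqrt (1 - p)) / c * exp (- t * (v\<^sup>2 / (2 * p * (1 - p))))
     = c / sqrt (p * (1 - p)) * exp (- (t / (2 * p * (1 - p))) * v\<^sup>2)"
    using c by (simp add: real_sqrt_mult)
  moreover have "eventually (\<lambda>n. (sqrt (real n) * stirling_weight (x n)) * (sqrt (real n) * stirling_weight (n - x n))
       / (sqrt (real n) * stirling_weight n)
       * exp (- t * (cell_div (x n) (real n * p) + cell_div (n - x n) (real n * (1 - p))))
     = sqrt (real n) * two_cell_term p t n (x n)) sequentially"
    using eventually_gt_at_top[of 0] by eventually_elim (simp add: two_cell_term_def)
  ultimately show "(\<lambda>n. sqrt (real n) * two_cell_term p t n (x n))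
    \<longlonglongrightarrow> c / sqrt (p * (1 - p)) * exp (- (t / (2 * p * (1 - p))) * v\<^sup>2)"
    by (simp add: Lim_transform_eventually)
qed

text \<open>\<open>exp (- cell_div x m)\<close> is \<open>(m / x) ^ x\<close>, which exchanges the
  power of \<open>x\<close> inside the Stirling weight for a power of \<open>m\<close>. This
  translates between the divergence form of a point mass and the usual one.\<close>

lemma stirling_weight_times_exp_cell_div:
  assumes "m > 0"
  shows "stirling_weight x * exp (- cell_div x m) = m ^ x * exp (- real x) / fact x"
proof (cases "x = 0")
  case False
  then have "exp (- cell_div x m) = exp (real x * ln (m / real x))"
    using assms by (simp add: cell_div_def ln_div algebra_simps)
  also have "\<dots> = (m / real x) ^ x"
    using False assms by (subst exp_of_nat_mult) simp
  finally show ?thesis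
    using False by (simp add: stirling_weight_def power_divide)
qed (simp add: cell_div_def)

lemma sum_two_cell_term_1:
  assumes "0 < p" "p < 1"
  shows "(\<Sum>x\<le>n. two_cell_term p 1 n x) = 1"
proof (cases "n = 0")
  case True
  then show ?thesis by (simp add: two_cell_term_def cell_div_def)
next
  case False
  have "two_cell_term p 1 n x = real (n choose x) * p ^ x * (1 - p) ^ (n - x)" if "x \<le> n" for x
  proof -
    have "two_cell_term p 1 n x = (stirling_weight x * exp (- cell_div x (real n * p)))
        * (stirling_weight (n - x) * exp (- cell_div (n - x) (real n * (1 - p)))) / stirling_weight n"
      by (simp add: two_cell_term_def exp_add[symmetric] exp_diff exp_minus field_simps)
    also have "\<dots> = ((real n * p) ^ x * exp (- real x) / fact x)
        * ((real n * (1 - p)) ^ (n - x) * exp (- real (n - x)) / fact (n - x)) / stirling_weight n"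
      using False assms by (subst (1 2) stirling_weight_times_exp_cell_div) auto
    also have "\<dots> = (fact n / (fact x * fact (n - x))) * p ^ x * (1 - p) ^ (n - x)
        * ((real n ^ x * real n ^ (n - x)) * (exp (- real x) * exp (- real (n - x))) / (real n ^ n * exp (- real n)))"
      by (simp add: stirling_weight_def power_mult_distrib)
    also have "exp (- real x) * exp (- real (n - x)) = exp (- real n)"
      using that by (simp add: of_nat_diff flip: exp_add)
    also have "real n ^ x * real n ^ (n - x) = real n ^ n"
      using that by (simp flip: power_add)
    finally show ?thesis
      using False that by (simp add: binomial_fact)
  qed
  then have "(\<Sum>x\<le>n. two_cell_term p 1 n x) = (\<Sum>x\<le>n. real (n choose x) * p ^ x * (1 - p) ^ (n - x))"
    by (intro sum.cong) auto
  also have "\<dots> = (p + (1 - p)) ^ n"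
    by (rule binomial_ring[symmetric])
  finally show ?thesis by simp
qed

text \<open>Each summand is spread over the unit interval \<open>[x, x + 1)\<close>, which makes a
  lattice sum accessible to substitution and dominated convergence.\<close>

lemma sum_eq_integral_step_function:
  fixes f :: "nat \<Rightarrow> real"
  shows "has_bochner_integral lborel (\<lambda>y. if 0 \<le> y \<and> y < real n + 1 then f (nat \<lfloor>y\<rfloor>) else 0) (\<Sum>x\<le>n. f x)"
proof -
  have "has_bochner_integral lborel (\<lambda>y. \<Sum>x\<le>n. f x * indicator {real x..<real x + 1} y) (\<Sum>x\<le>n. f x * 1)"
    by (intro has_bochner_integral_sum has_bochner_integral_mult_right)
      (auto simp: has_bochner_integral_iff intro!: integrable_real_indicator)
  moreover have "(\<Sum>x\<le>n. f x * indicator {real x..<real x + 1} y)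
      = (if 0 \<le> y \<and> y < real n + 1 then f (nat \<lfloor>y\<rfloor>) else 0)" for y
  proof -
    have "indicator {real x..<real x + 1} y = (if 0 \<le> y \<and> x = nat \<lfloor>y\<rfloor> then 1 else 0 :: real)" for x
    proof -
      have "y \<in> {real x..<real x + 1} \<longleftrightarrow> 0 \<le> y \<and> x = nat \<lfloor>y\<rfloor>"
        by (auto simp: le_floor_iff floor_less_iff) linarith+
      then show ?thesis by (simp add: indicator_def)
    qed
    then have "(\<Sum>x\<le>n. f x * indicator {real x..<real x + 1} y)
        = (\<Sum>x\<le>n. if x = nat \<lfloor>y\<rfloor> then (if 0 \<le> y then f x else 0) else 0)"
      by (intro sum.cong) auto
    also have "\<dots> = (if nat \<lfloor>y\<rfloor> \<le> n then (if 0 \<le> y then f (nat \<lfloor>y\<rfloor>) else 0) else 0)"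
      by (simp add: sum.delta)
    also have "\<dots> = (if 0 \<le> y \<and> y < real n + 1 then f (nat \<lfloor>y\<rfloor>) else 0)"
    proof -
      have "nat \<lfloor>y\<rfloor> \<le> n \<longleftrightarrow> y < real n + 1" if "0 \<le> y"
        using that by (auto simp: nat_le_iff floor_le_iff)
      then show ?thesis by auto
    qed
    finally show ?thesis .
  qed
  ultimately show ?thesis by simp
qed

text \<open>
  The sum is the integral of a step function; after the substitution \<open>y = n p + sqrt n u\<close> it
  converges by dominated convergence to a Gaussian integral. The Stirling constant \<open>c\<close> is identified
  afterwards from the case \<open>t = 1\<close>, \<open>a = 1\<close>, where the sum is the total mass of a binomial distribution.
\<close>

lemma two_cell_sum_limit_aux:
  fixes a :: "nat \<Rightarrow> real"
  assumes p: "0 < p" "p < 1" and t: "t > 0" and a: "a \<longlonglongrightarrow> L"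
    and c: "c > 0" "(\<lambda>n. sqrt (real n) * stirling_weight n) \<longlonglongrightarrow> c"
  shows "(\<lambda>n. \<Sum>x\<le>n. two_cell_term p t n x * a (n - x)) \<longlonglongrightarrow> c * sqrt (2 * pi / t) * L"
proof -
  define F where "F n x = two_cell_term p t n x * a (n - x)" for n x
  define g where "g n y = (if 0 \<le> y \<and> y < real n + 1 then F n (nat \<lfloor>y\<rfloor>) else 0)" for n y
  define h where "h n u = sqrt (real n) * g n (real n * p + sqrt (real n) * u)" for n u
  define b where "b = t / (2 * p * (1 - p))"
  have b: "b > 0" using p t by (simp add: b_def)
  obtain A where A: "A > 0" "\<And>n. \<bar>a n\<bar> \<le> A"
    using convergent_imp_Bseq[OF convergentI[OF a]] by (auto simp: Bseq_def)
  obtain K where K: "K > 0" "\<And>n x. n > 0 \<Longrightarrow> x \<le> n \<Longrightarrow> sqrt (real n) * two_cell_term p t n x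
    \<le> K * (1 + \<bar>real x - real n * p\<bar> / sqrt (real n))\<^sup>2 * exp (- t / 2 * ((real x - real n * p) / sqrt (real n))\<^sup>2)"
    using two_cell_term_bound[OF p t] by metis
  have g_meas [measurable]: "g n \<in> borel_measurable borel" for n
    using has_bochner_integral_iff[THEN iffD1, OF sum_eq_integral_step_function[of n "F n"]]
    unfolding g_def by (auto dest: borel_measurable_integrable)
  have h_meas: "h n \<in> borel_measurable lborel" for n
    unfolding h_def by measurable
  have floor_close: "\<bar>(real (nat \<lfloor>real n * p + sqrt (real n) * u\<rfloor>) - real n * p) / sqrt (real n) - u\<bar> \<le> 1 / sqrt (real n)"
    if "n > 0" "0 \<le> real n * p + sqrt (real n) * u" for n u
  proof -
    define y where "y = real n * p + sqrt (real n) * u"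
    have s: "sqrt (real n) > 0" using that by simp
    have "\<bar>real (nat \<lfloor>y\<rfloor>) - y\<bar> \<le> 1"
      using that(2) unfolding y_def[symmetric] by linarith
    moreover have "(real (nat \<lfloor>y\<rfloor>) - real n * p) / sqrt (real n) - u = (real (nat \<lfloor>y\<rfloor>) - y) / sqrt (real n)"
      using s by (simp add: y_def field_simps)
    ultimately show ?thesis
      using s unfolding y_def[symmetric] by (simp add: divide_right_mono)
  qed
  have "(\<lambda>n. integral\<^sup>L lborel (h n)) \<longlonglongrightarrow> integral\<^sup>L lborel (\<lambda>u. L * (c / sqrt (p * (1 - p))) * exp (- b * u\<^sup>2))"
  proof (rule integral_dominated_convergence)
    \<comment> \<open>The available bound is in terms of the deviation \<open>v\<close> of the
      rounded point, while the majorant must depend on \<open>u\<close> alone. From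
      \<open>|v - u| <= 1\<close> follow \<open>1 + |v| <= 2 + |u|\<close> and
      \<open>v^2 >= u^2 / 2 - 1\<close>; the latter lowers the rate to \<open>t / 4\<close> and
      costs \<open>exp (t / 2)\<close>. \<open>A\<close> bounds the sequence
      \<open>a\<close>.\<close>
    show "integrable lborel (\<lambda>u. A * K * exp (t / 2) * ((2 + \<bar>u\<bar>)\<^sup>2 * exp (- (t / 4) * u\<^sup>2)))"
      using t by (intro integrable_mult_right integrable_quadratic_gaussian) auto
    show "AE u in lborel. norm (h n u) \<le> A * K * exp (t / 2) * ((2 + \<bar>u\<bar>)\<^sup>2 * exp (- (t / 4) * u\<^sup>2))" for n
    proof (rule AE_I2)
      fix u :: real
      define y where "y = real n * p + sqrt (real n) * u"
      define x where "x = nat \<lfloor>y\<rfloor>"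
      define v where "v = (real x - real n * p) / sqrt (real n)"
      show "norm (h n u) \<le> A * K * exp (t / 2) * ((2 + \<bar>u\<bar>)\<^sup>2 * exp (- (t / 4) * u\<^sup>2))"
      proof (cases "n > 0 \<and> 0 \<le> y \<and> y < real n + 1")
        case False
        then have "h n u = 0"
          by (auto simp: h_def g_def y_def)
        then show ?thesis using A K by simp
      next
        case True
        then have n: "n > 0" and x: "x \<le> n"
          unfolding x_def by linarith+
        have "1 / sqrt (real n) \<le> 1" using n by simp
        with floor_close[OF n, of u] True have vu: "\<bar>v - u\<bar> \<le> 1"
          unfolding v_def x_def y_def by linarith
        have "(v - u)\<^sup>2 \<le> 1"
          using vu by (simp add: abs_square_le_1)
        moreover have "u\<^sup>2 \<le> 2 * v\<^sup>2 + 2 * (v - u)\<^sup>2"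
          using zero_le_power2[of "2 * v - u"] by (simp add: power2_eq_square algebra_simps)
        ultimately have "u\<^sup>2 / 2 - 1 \<le> v\<^sup>2" by linarith
        then have "t / 2 * (u\<^sup>2 / 2 - 1) \<le> t / 2 * v\<^sup>2"
          using t by (intro mult_left_mono) auto
        then have e: "exp (- t / 2 * v\<^sup>2) \<le> exp (t / 2) * exp (- (t / 4) * u\<^sup>2)"
          by (simp add: algebra_simps flip: exp_add)
        have q: "(1 + \<bar>v\<bar>)\<^sup>2 \<le> (2 + \<bar>u\<bar>)\<^sup>2"
          using vu by (intro power_mono) auto
        have "sqrt (real n) * two_cell_term p t n x \<le> K * (1 + \<bar>v\<bar>)\<^sup>2 * exp (- t / 2 * v\<^sup>2)"
          using K(2)[OF n x] by (simp add: v_def)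
        also have "\<dots> \<le> K * (2 + \<bar>u\<bar>)\<^sup>2 * (exp (t / 2) * exp (- (t / 4) * u\<^sup>2))"
          using K(1) by (intro mult_mono[OF mult_left_mono[OF q] e]) auto
        finally have "sqrt (real n) * two_cell_term p t n x * \<bar>a (n - x)\<bar>
            \<le> K * (2 + \<bar>u\<bar>)\<^sup>2 * (exp (t / 2) * exp (- (t / 4) * u\<^sup>2)) * A"
          using A(2)[of "n - x"] by (rule mult_mono) (use K(1) in auto)
        moreover have "norm (h n u) = sqrt (real n) * two_cell_term p t n x * \<bar>a (n - x)\<bar>"
          using True by (simp add: h_def g_def F_def abs_mult two_cell_term_nonneg flip: y_def x_def)
        ultimately show ?thesis by (simp add: mult_ac)
      qed
    qed
    show "AE u in lborel. (\<lambda>n. h n u) \<longlonglongrightarrow> L * (c / sqrt (p * (1 - p))) * exp (- b * u\<^sup>2)"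
    proof (rule AE_I2)
      fix u :: real
      define y where "y n = real n * p + sqrt (real n) * u" for n
      \<comment> \<open>The minimum guarantees \<open>x n <= n\<close> for every \<open>n\<close>,
        as the pointwise limit lemma demands; eventually it has no effect, because
        \<open>p < 1\<close>.\<close>
      define x where "x n = min n (nat \<lfloor>y n\<rfloor>)" for n
      have "eventually (\<lambda>n. 0 \<le> real n * p + sqrt (real n) * u) sequentially"
        using p by real_asymp
      moreover have "eventually (\<lambda>n. real n * p + sqrt (real n) * u < real n + 1) sequentially"
        using p by real_asymp
      ultimately have ev: "eventually (\<lambda>n. n > 0 \<and> 0 \<le> y n \<and> y n < real n + 1 \<and> x n = nat \<lfloor>y n\<rfloor>) sequentially"
        using eventually_gt_at_top[of 0]
      proof eventually_elim
        case (elim n)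
        then have "nat \<lfloor>y n\<rfloor> \<le> n"
          unfolding y_def by linarith
        with elim show ?case by (simp add: y_def x_def)
      qed
      have "(\<lambda>n. (real (x n) - real n * p) / sqrt (real n) - u) \<longlonglongrightarrow> 0"
      proof (rule Lim_null_comparison)
        show "eventually (\<lambda>n. norm ((real (x n) - real n * p) / sqrt (real n) - u) \<le> 1 / sqrt (real n)) sequentially"
          using ev by eventually_elim (metis floor_close y_def real_norm_def)
        show "(\<lambda>n. 1 / sqrt (real n)) \<longlonglongrightarrow> 0" by real_asymp
      qed
      then have lim: "(\<lambda>n. (real (x n) - real n * p) / sqrt (real n)) \<longlonglongrightarrow> u"
        using LIM_zero_iff by blast
      have xn: "x n \<le> n" for n by (simp add: x_def)
      have "(\<lambda>n. a (n - x n) * (sqrt (real n) * two_cell_term p t n (x n)))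
          \<longlonglongrightarrow> L * (c / sqrt (p * (1 - p)) * exp (- b * u\<^sup>2))"
        unfolding b_def by (intro tendsto_mult filterlim_compose[OF a two_cell_term_limit(2)[OF p xn lim c]]
            two_cell_term_limit(1)[OF p xn lim c])
      moreover have "eventually (\<lambda>n. a (n - x n) * (sqrt (real n) * two_cell_term p t n (x n)) = h n u) sequentially"
        using ev by eventually_elim (auto simp: h_def g_def F_def simp flip: y_def)
      ultimately show "(\<lambda>n. h n u) \<longlonglongrightarrow> L * (c / sqrt (p * (1 - p))) * exp (- b * u\<^sup>2)"
        by (simp add: Lim_transform_eventually mult.assoc)
    qed
  qed (use h_meas in auto)
  moreover have "integral\<^sup>L lborel (\<lambda>u. L * (c / sqrt (p * (1 - p))) * exp (- b * u\<^sup>2)) = c * sqrt (2 * pi / t) * L"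
  proof -
    have "integral\<^sup>L lborel (\<lambda>u. L * (c / sqrt (p * (1 - p))) * exp (- b * u\<^sup>2))
        = L * (c / sqrt (p * (1 - p))) * sqrt (pi / b)"
      using gaussian_has_bochner_integral[OF b] by (simp add: has_bochner_integral_iff)
    \<comment> \<open>The width of the Gaussian contributes \<open>sqrt (p * (1 - p))\<close>, which
      cancels the same factor in the pointwise limit. So the limit is independent of
      \<open>p\<close>.\<close>
    also have "pi / b = (2 * pi / t) * (p * (1 - p))"
      using p by (simp add: b_def)
    also have "sqrt \<dots> = sqrt (2 * pi / t) * sqrt (p * (1 - p))"
      by (rule real_sqrt_mult)
    finally show ?thesis using p by simp
  qed
  moreover have "eventually (\<lambda>n. integral\<^sup>L lborel (h n) = (\<Sum>x\<le>n. F n x)) sequentially"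
    using eventually_gt_at_top[of 0]
  proof eventually_elim
    case (elim n)
    then have "(\<integral>y. g n y \<partial>lborel) = \<bar>sqrt (real n)\<bar> *\<^sub>R (\<integral>u. g n (real n * p + sqrt (real n) * u) \<partial>lborel)"
      by (intro lborel_integral_real_affine) simp
    also have "\<dots> = integral\<^sup>L lborel (h n)"
      unfolding h_def[abs_def] by simp
    finally show ?case
      using has_bochner_integral_integral_eq[OF sum_eq_integral_step_function[of n "F n"]]
      by (simp add: g_def)
  qed
  ultimately show ?thesis
    unfolding F_def by (simp add: Lim_transform_eventually)
qed

lemma two_cell_sum_limit:
  fixes a :: "nat \<Rightarrow> real"
  assumes p: "0 < p" "p < 1" and t: "t > 0" and a: "a \<longlonglongrightarrow> L"
  shows "(\<lambda>n. \<Sum>x\<le>n. two_cell_term p t n x * a (n - x)) \<longlonglongrightarrow> L / sqrt t"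
proof -
  obtain c where c: "c > 0" "(\<lambda>n. sqrt (real n) * stirling_weight n) \<longlonglongrightarrow> c"
    using stirling_weight_limit .
  have "(\<lambda>n. \<Sum>x\<le>n. two_cell_term p 1 n x * 1) \<longlonglongrightarrow> c * sqrt (2 * pi / 1) * 1"
    by (rule two_cell_sum_limit_aux[OF p _ _ c]) auto
  then have "c * sqrt (2 * pi) = 1"
    by (simp add: sum_two_cell_term_1[OF p] LIMSEQ_const_iff)
  then have "c * sqrt (2 * pi / t) * L = L / sqrt t"
    by (simp add: real_sqrt_divide)
  then show ?thesis
    using two_cell_sum_limit_aux[OF p t a c] by simp
qed

section \<open>The multinomial moment generating function\<close>

text \<open>
  The point mass times \<open>exp (s \<cdot> 2 n V)\<close> with \<open>t = 1 - 2 s\<close>: the powers of \<open>p i\<close> in the mass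
  combine to \<open>exp (- n V)\<close>.
\<close>

definition tilted_mass :: "real \<Rightarrow> nat \<Rightarrow> nat \<Rightarrow> (nat \<Rightarrow> real) \<Rightarrow> (nat \<Rightarrow> nat) \<Rightarrow> real" where
  "tilted_mass t n k p z = (\<Prod>i\<in>{1..k}. stirling_weight (z i)) / stirling_weight n
     * exp (- t * (\<Sum>i\<in>{1..k}. cell_div (z i) (real n * p i)))"

lemma V_stat_eq_sum_cell_div:
  assumes "x \<in> mult_outcomes n k"
  shows "real n * V_stat n k p x = (\<Sum>i\<in>{1..k}. cell_div (x i) (real n * p i))"
proof (cases "n = 0")
  case True
  then have "x i = 0" if "i \<in> {1..k}" for i
    using assms that by (auto simp: mult_outcomes_def)
  then show ?thesis
    using True by (simp add: cell_div_def)
next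
  case False
  then show ?thesis
    by (auto simp: V_stat_def KL_div_def cell_div_def sum_distrib_left intro!: sum.cong)
qed

lemma mult_pmf_times_exp:
  assumes p: "\<And>i. i \<in> {1..k} \<Longrightarrow> p i > 0" and x: "x \<in> mult_outcomes n k"
  shows "mult_pmf n k p x * exp (s * (2 * real n * V_stat n k p x)) = tilted_mass (1 - 2 * s) n k p x"
proof -
  define S where "S = (\<Sum>i\<in>{1..k}. cell_div (x i) (real n * p i))"
  have sum_x: "(\<Sum>i\<in>{1..k}. x i) = n"
    using x by (simp add: mult_outcomes_def)
  have *: "stirling_weight (x i) * exp (- cell_div (x i) (real n * p i))
      = (real n * p i) ^ x i * exp (- real (x i)) / fact (x i)" if "i \<in> {1..k}" for i
  proof (cases "n = 0")
    case True
    then have "x i = 0" using sum_x that by simp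
    then show ?thesis by (simp add: cell_div_def)
  next
    case False
    then show ?thesis using p[OF that] by (intro stirling_weight_times_exp_cell_div) simp
  qed
  \<comment> \<open>The untilted case is settled first, cell by cell: the powers of \<open>n\<close>
    and of \<open>exp (- 1)\<close> collect to \<open>n ^ n * exp (- n)\<close>, and division by
    \<open>stirling_weight n\<close> leaves \<open>fact n\<close>.\<close>
  have "tilted_mass 1 n k p x
      = (\<Prod>i\<in>{1..k}. stirling_weight (x i) * exp (- cell_div (x i) (real n * p i))) / stirling_weight n"
    by (simp add: tilted_mass_def prod.distrib exp_sum flip: sum_negf)
  also have "\<dots> = (\<Prod>i\<in>{1..k}. real n ^ x i * p i ^ x i * exp (- real (x i)) / fact (x i)) / stirling_weight n"
    by (intro arg_cong2[where f = "(/)"] prod.cong refl) (simp only: * power_mult_distrib)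
  also have "\<dots> = (\<Prod>i\<in>{1..k}. p i ^ x i) / (\<Prod>i\<in>{1..k}. fact (x i))
      * (\<Prod>i\<in>{1..k}. real n ^ x i) * (\<Prod>i\<in>{1..k}. exp (- real (x i))) / stirling_weight n"
    by (simp add: prod.distrib prod_dividef)
  also have "(\<Prod>i\<in>{1..k}. real n ^ x i) = real n ^ n"
    by (simp only: power_sum[symmetric] sum_x)
  also have "(\<Prod>i\<in>{1..k}. exp (- real (x i))) = exp (- real n)"
    using sum_x by (simp add: sum_negf flip: exp_sum of_nat_sum)
  also have "(\<Prod>i\<in>{1..k}. p i ^ x i) / (\<Prod>i\<in>{1..k}. fact (x i)) * real n ^ n * exp (- real n) / stirling_weight n
      = mult_pmf n k p x"
    by (cases "n = 0") (auto simp: stirling_weight_def mult_pmf_def)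
  finally have pmf: "mult_pmf n k p x = tilted_mass 1 n k p x" ..
  have V: "s * (2 * real n * V_stat n k p x) = 2 * s * S"
    using V_stat_eq_sum_cell_div[OF x, of p] by (simp add: S_def)
  have "exp (- 1 * S) * exp (2 * s * S) = exp (- (1 - 2 * s) * S)"
    by (simp add: algebra_simps flip: exp_add)
  then show ?thesis
    unfolding V pmf tilted_mass_def S_def[symmetric] by (simp only: mult.assoc)
qed

section \<open>Conditioning on the last cell\<close>

lemma bij_betw_mult_outcomes_Suc:
  "bij_betw (\<lambda>(x, y). y(Suc k := x)) (SIGMA x:{..n}. mult_outcomes (n - x) k) (mult_outcomes n (Suc k))"
proof (rule bij_betwI)
  show "(\<lambda>(x, y). y(Suc k := x)) \<in> (SIGMA x:{..n}. mult_outcomes (n - x) k) \<rightarrow> mult_outcomes n (Suc k)"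
  proof safe
    fix x y assume x: "x \<le> n" and y: "y \<in> mult_outcomes (n - x) k"
    have "(\<Sum>i\<in>{1..k}. (y(Suc k := x)) i) = (\<Sum>i\<in>{1..k}. y i)"
      by (intro sum.cong) auto
    then show "y(Suc k := x) \<in> mult_outcomes n (Suc k)"
      using x y by (auto simp: mult_outcomes_def)
  qed
  \<comment> \<open>Resetting to 0 is the right inverse operation because outcomes are required to
    vanish outside \<open>{1..k}\<close>.\<close>
  show "(\<lambda>z. (z (Suc k), z(Suc k := 0))) \<in> mult_outcomes n (Suc k) \<rightarrow> (SIGMA x:{..n}. mult_outcomes (n - x) k)"
  proof
    fix z assume z: "z \<in> mult_outcomes n (Suc k)"
    have "(\<Sum>i\<in>{1..k}. (z(Suc k := 0)) i) = (\<Sum>i\<in>{1..k}. z i)"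
      by (intro sum.cong) auto
    then show "(z (Suc k), z(Suc k := 0)) \<in> (SIGMA x:{..n}. mult_outcomes (n - x) k)"
      using z by (auto simp: mult_outcomes_def)
  qed
qed (auto simp: mult_outcomes_def fun_eq_iff)

lemma finite_mult_outcomes: "finite (mult_outcomes n k)"
proof (induction k arbitrary: n)
  case 0
  have "mult_outcomes n 0 \<subseteq> {\<lambda>_. 0}"
    by (auto simp: mult_outcomes_def)
  then show ?case by (rule finite_subset) simp
next
  case (Suc k)
  then show ?case
    using bij_betw_finite[OF bij_betw_mult_outcomes_Suc[of k n]] by auto
qed

lemma sum_mult_outcomes_Suc:
  "(\<Sum>z\<in>mult_outcomes n (Suc k). f z) = (\<Sum>x\<le>n. \<Sum>y\<in>mult_outcomes (n - x) k. f (y(Suc k := x)))"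
proof -
  have "(\<Sum>z\<in>mult_outcomes n (Suc k). f z)
      = (\<Sum>xy\<in>(SIGMA x:{..n}. mult_outcomes (n - x) k). f ((\<lambda>(x, y). y(Suc k := x)) xy))"
    by (rule sum.reindex_bij_betw[symmetric, OF bij_betw_mult_outcomes_Suc])
  also have "\<dots> = (\<Sum>x\<le>n. \<Sum>y\<in>mult_outcomes (n - x) k. f (y(Suc k := x)))"
    by (subst sum.Sigma) (auto simp: finite_mult_outcomes case_prod_unfold)
  finally show ?thesis .
qed

text \<open>The chain rule for divergence. Passing to the conditional probabilities
  \<open>p i / q\<close> changes the logarithm of every occupied cell by the same
  \<open>ln (N / (n * q))\<close>, and the cell counts add up to \<open>N\<close>.\<close>

lemma sum_cell_div_rescale:
  assumes p: "\<And>i. i \<in> {1..k} \<Longrightarrow> p i > 0" and q: "q > 0"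
    and y: "y \<in> mult_outcomes N k" and "N \<le> n"
  shows "(\<Sum>i\<in>{1..k}. cell_div (y i) (real n * p i))
    = (\<Sum>i\<in>{1..k}. cell_div (y i) (real N * (p i / q))) + cell_div N (real n * q)"
proof -
  have sum_y: "(\<Sum>i\<in>{1..k}. y i) = N"
    using y by (simp add: mult_outcomes_def)
  have "cell_div (y i) (real n * p i)
      = cell_div (y i) (real N * (p i / q)) + real (y i) * ln (real N / (real n * q))"
    if i: "i \<in> {1..k}" for i
  proof (cases "y i = 0")
    case True
    then show ?thesis by (simp add: cell_div_def)
  next
    case False
    then have "N > 0"
      using sum_y i member_le_sum[of i "{1..k}" y] by fastforce
    then have "N > 0" "n > 0"
      using \<open>N \<le> n\<close> by auto
    moreover from this have "real (y i) / (real n * p i) = real (y i) / (real N * (p i / q)) * (real N / (real n * q))"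
      using q by simp
    ultimately have "ln (real (y i) / (real n * p i)) = ln (real (y i) / (real N * (p i / q))) + ln (real N / (real n * q))"
      using False p[OF i] q by (simp only: ) (rule ln_mult_pos, simp_all)
    then show ?thesis
      using False by (simp add: cell_div_def algebra_simps)
  qed
  then have "(\<Sum>i\<in>{1..k}. cell_div (y i) (real n * p i))
      = (\<Sum>i\<in>{1..k}. cell_div (y i) (real N * (p i / q))) + (\<Sum>i\<in>{1..k}. real (y i) * ln (real N / (real n * q)))"
    by (simp add: sum.distrib)
  also have "(\<Sum>i\<in>{1..k}. real (y i) * ln (real N / (real n * q))) = real N * ln (real N / (real n * q))"
    by (simp only: sum_distrib_right[symmetric] of_nat_sum[symmetric] sum_y)
  also have "\<dots> = cell_div N (real n * q)"
    by (simp add: cell_div_def)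
  finally show ?thesis .
qed

text \<open>The divergences split by the chain rule, and the weight
  \<open>stirling_weight (n - x)\<close> cancels between the numerator of the two-cell term and the
  denominator of the smaller mass. The exponential factorizes for every \<open>t\<close>, not only
  for probabilities.\<close>

lemma tilted_mass_Suc:
  assumes p: "\<And>i. i \<in> {1..Suc k} \<Longrightarrow> p i > 0" and p1: "p (Suc k) < 1"
    and x: "x \<le> n" and y: "y \<in> mult_outcomes (n - x) k"
  shows "tilted_mass t n (Suc k) p (y(Suc k := x))
    = two_cell_term (p (Suc k)) t n x * tilted_mass t (n - x) k (\<lambda>i. p i / (1 - p (Suc k))) y"
proof -
  have "(\<Sum>i\<in>{1..Suc k}. cell_div ((y(Suc k := x)) i) (real n * p i))
      = (\<Sum>i\<in>{1..k}. cell_div ((y(Suc k := x)) i) (real n * p i)) + cell_div x (real n * p (Suc k))"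
    by simp
  also have "(\<Sum>i\<in>{1..k}. cell_div ((y(Suc k := x)) i) (real n * p i))
      = (\<Sum>i\<in>{1..k}. cell_div (y i) (real n * p i))"
    by (intro sum.cong) auto
  also have "(\<Sum>i\<in>{1..k}. cell_div (y i) (real n * p i))
      = (\<Sum>i\<in>{1..k}. cell_div (y i) (real (n - x) * (p i / (1 - p (Suc k)))))
        + cell_div (n - x) (real n * (1 - p (Suc k)))"
    using p1 by (intro sum_cell_div_rescale y p) auto
  finally have S: "(\<Sum>i\<in>{1..Suc k}. cell_div ((y(Suc k := x)) i) (real n * p i))
      = (cell_div x (real n * p (Suc k)) + cell_div (n - x) (real n * (1 - p (Suc k))))
        + (\<Sum>i\<in>{1..k}. cell_div (y i) (real (n - x) * (p i / (1 - p (Suc k)))))"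
    by simp
  have "(\<Prod>i\<in>{1..k}. stirling_weight ((y(Suc k := x)) i)) = (\<Prod>i\<in>{1..k}. stirling_weight (y i))"
    by (intro prod.cong) auto
  then have "(\<Prod>i\<in>{1..Suc k}. stirling_weight ((y(Suc k := x)) i))
      = (\<Prod>i\<in>{1..k}. stirling_weight (y i)) * stirling_weight x"
    by simp
  then show ?thesis
    unfolding tilted_mass_def two_cell_term_def S distrib_left exp_add
    using stirling_weight_pos[of "n - x"] by simp
qed

text \<open>With one cell the sum is identically 1; every further cell multiplies the limit by
  \<open>1 / sqrt t\<close>. The inner sum over the smaller multinomial is the convergent sequence
  \<open>a\<close> of \<open>two_cell_sum_limit\<close>, and \<open>p\<close> varies in the
  induction because conditioning renormalizes it.\<close>

lemma tilted_mass_sum_limit: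
  assumes "k \<ge> 1" "t > 0" "\<And>i. i \<in> {1..k} \<Longrightarrow> p i > 0" "(\<Sum>i\<in>{1..k}. p i) = 1"
  shows "(\<lambda>n. \<Sum>z\<in>mult_outcomes n k. tilted_mass t n k p z) \<longlonglongrightarrow> 1 / sqrt t ^ (k - 1)"
  using assms(1,3,4)
proof (induction k arbitrary: p rule: dec_induct)
  case base
  have "mult_outcomes n 1 = {(\<lambda>_. 0)(1 := n)}" for n
    by (auto simp: mult_outcomes_def fun_eq_iff)
  moreover have "stirling_weight n \<noteq> 0" for n
    using stirling_weight_pos[of n] by simp
  moreover have "cell_div n (real n) = 0" for n
    by (simp add: cell_div_def)
  ultimately show ?case
    using base by (simp add: tilted_mass_def)
next
  case (step k)
  define P where "P = p (Suc k)"
  have sum_p: "(\<Sum>i\<in>{1..k}. p i) = 1 - P"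
    using step.prems(2) by (simp add: P_def)
  have "(\<Sum>i\<in>{1..k}. p i) > 0"
    using step.hyps(1) step.prems(1) by (intro sum_pos) auto
  then have P: "0 < P" "P < 1"
    using step.prems(1) sum_p by (auto simp: P_def)
  have "(\<Sum>i\<in>{1..k}. p i / (1 - P)) = 1"
    using sum_p P by (simp flip: sum_divide_distrib)
  then have "(\<lambda>n. \<Sum>z\<in>mult_outcomes n k. tilted_mass t n k (\<lambda>i. p i / (1 - P)) z) \<longlonglongrightarrow> 1 / sqrt t ^ (k - 1)"
    using P step.prems(1) by (intro step.IH) auto
  from two_cell_sum_limit[OF P \<open>t > 0\<close> this]
  have "(\<lambda>n. \<Sum>x\<le>n. two_cell_term P t n x * (\<Sum>z\<in>mult_outcomes (n - x) k. tilted_mass t (n - x) k (\<lambda>i. p i / (1 - P)) z))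
      \<longlonglongrightarrow> 1 / sqrt t ^ (k - 1) / sqrt t" .
  moreover have "1 / sqrt t ^ (k - 1) / sqrt t = 1 / sqrt t ^ (Suc k - 1)"
    using step.hyps(1) by (cases k) auto
  moreover have "(\<Sum>x\<le>n. two_cell_term P t n x * (\<Sum>z\<in>mult_outcomes (n - x) k. tilted_mass t (n - x) k (\<lambda>i. p i / (1 - P)) z))
      = (\<Sum>z\<in>mult_outcomes n (Suc k). tilted_mass t n (Suc k) p z)" for n
    unfolding sum_mult_outcomes_Suc sum_distrib_left P_def
    using P step.prems(1) by (intro sum.cong refl tilted_mass_Suc[symmetric]) (auto simp: P_def)
  ultimately show ?case by simp
qed

lemma mult_expect_exp_limit:
  assumes "k \<ge> 1" "s < 1 / 2" "\<And>i. i \<in> {1..k} \<Longrightarrow> p i > 0" "(\<Sum>i\<in>{1..k}. p i) = 1"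
  shows "(\<lambda>n. mult_expect n k p (\<lambda>x. exp (s * (2 * real n * V_stat n k p x))))
    \<longlonglongrightarrow> (1 - 2 * s) powr (- (real (k - 1) / 2))"
proof -
  have "mult_expect n k p (\<lambda>x. exp (s * (2 * real n * V_stat n k p x)))
      = (\<Sum>z\<in>mult_outcomes n k. tilted_mass (1 - 2 * s) n k p z)" for n
    unfolding mult_expect_def using assms(3) by (intro sum.cong refl mult_pmf_times_exp)
  moreover have "1 / sqrt (1 - 2 * s) ^ (k - 1) = (1 - 2 * s) powr (- (real (k - 1) / 2))"
  proof -
    have "sqrt (1 - 2 * s) ^ (k - 1) = ((1 - 2 * s) powr (1 / 2)) powr real (k - 1)"
      using assms(2) by (simp add: powr_half_sqrt powr_realpow)
    then show ?thesis
      by (simp add: powr_powr powr_minus_divide)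
  qed
  ultimately show ?thesis
    using tilted_mass_sum_limit[of k "1 - 2 * s" p] assms by simp
qed

text \<open>Gibbs' inequality: the linear lower bounds of the cells sum to 0. It places
  \<open>exp (- 2 n V)\<close> in \<open>[0, 1]\<close>, where polynomial approximation is
  uniform.\<close>

lemma V_stat_nonneg:
  assumes "\<And>i. i \<in> {1..k} \<Longrightarrow> p i > 0" "(\<Sum>i\<in>{1..k}. p i) = 1" "x \<in> mult_outcomes n k"
  shows "real n * V_stat n k p x \<ge> 0"
proof (cases "n = 0")
  case False
  have "(\<Sum>i\<in>{1..k}. real (x i) - real n * p i) \<le> (\<Sum>i\<in>{1..k}. cell_div (x i) (real n * p i))"
  proof (rule sum_mono)
    fix i assume i: "i \<in> {1..k}"
    \<comment> \<open>The scale of the bound is taken as \<open>m + x\<close>, so that its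
      conditions \<open>m <= n\<close> and \<open>real x <= n\<close> are immediate.\<close>
    have "cell_div (x i) (real n * p i) \<ge> real (x i) - real n * p i
        + (real (x i) - real n * p i)\<^sup>2 / (4 * (real n * p i + real (x i)))"
      using False assms(1)[OF i] by (intro cell_div_lower_bound) (auto intro: add_pos_nonneg)
    moreover have "(real (x i) - real n * p i)\<^sup>2 / (4 * (real n * p i + real (x i))) \<ge> 0"
      using assms(1)[OF i] by simp
    ultimately show "real (x i) - real n * p i \<le> cell_div (x i) (real n * p i)"
      by linarith
  qed
  moreover have "(\<Sum>i\<in>{1..k}. real (x i)) = real n"
    using assms(3) by (simp add: mult_outcomes_def flip: of_nat_sum)
  then have "(\<Sum>i\<in>{1..k}. real (x i) - real n * p i) = 0"
    using assms(2) by (simp add: sum_subtractf flip: sum_distrib_left)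
  ultimately show ?thesis
    by (simp add: V_stat_eq_sum_cell_div[OF assms(3)])
qed simp

section \<open>The chi-squared distribution and exponential moments\<close>

lemma gamma_density_has_bochner_integral:
  fixes a b :: real
  assumes "a > 0" "b > 0"
  shows "has_bochner_integral lborel (\<lambda>x. if x > 0 then x powr (a - 1) * exp (- b * x) else 0) (Gamma a / b powr a)"
proof -
  define g where "g x = (if x > 0 then x powr (a - 1) * exp (- x) else 0)" for x :: real
  have g_meas: "g \<in> borel_measurable borel"
    unfolding g_def by measurable
  have "has_bochner_integral lborel g (Gamma a)"
  proof (rule has_bochner_integral_nn_integral)
    have "(\<integral>\<^sup>+x. ennreal (g x) \<partial>lborel)
        = (\<integral>\<^sup>+t. ennreal (indicator {0..} t * t powr (a - 1) / exp t) \<partial>lborel)"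
      by (intro nn_integral_cong) (auto simp: g_def indicator_def exp_minus field_simps)
    then show "(\<integral>\<^sup>+x. ennreal (g x) \<partial>lborel) = ennreal (Gamma a)"
      using Gamma_conv_nn_integral_real[OF assms(1)] by simp
  qed (use assms g_meas in \<open>auto simp: g_def Gamma_real_pos less_imp_le\<close>)
  then have "has_bochner_integral lborel (\<lambda>x. g (0 + b * x)) (Gamma a /\<^sub>R \<bar>b\<bar>)"
    using assms by (subst (asm) lborel_has_bochner_integral_real_affine_iff[of b _ _ 0]) auto
  then have "has_bochner_integral lborel (\<lambda>x. b powr (1 - a) * g (b * x)) (b powr (1 - a) * (Gamma a / b))"
    using assms by (intro has_bochner_integral_mult_right) (simp add: divide_inverse mult.commute)
  moreover have "b powr (1 - a) * (Gamma a / b) = Gamma a / b powr a"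
    using assms by (simp add: powr_diff)
  moreover have "b powr (1 - a) * g (b * x) = (if x > 0 then x powr (a - 1) * exp (- b * x) else 0)" for x
  proof -
    have "b powr (1 - a) * b powr (a - 1) = 1"
      using assms by (simp flip: powr_add)
    then show ?thesis
      using assms by (auto simp: g_def powr_mult zero_less_mult_iff)
  qed
  ultimately show ?thesis by simp
qed

section \<open>Power and exponential moments of the chi-squared distribution\<close>

lemma chi_sq_density_nonneg: "\<nu> > 0 \<Longrightarrow> chi_sq_density \<nu> x \<ge> 0"
  by (simp add: chi_sq_density_def Gamma_real_pos less_imp_le)

lemma chi_sq_density_measurable [measurable]: "chi_sq_density \<nu> \<in> borel_measurable borel"
  unfolding chi_sq_density_def by measurable

text \<open>Multiplying the density by \<open>y powr r * exp (s * y)\<close> gives an unnormalized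
  gamma density of shape \<open>r + \<nu> / 2\<close> and rate \<open>1 / 2 - s\<close>. One formula
  thus serves moments (\<open>s = 0\<close>) and the moment generating function
  (\<open>r = 0\<close>).\<close>

lemma chi_sq_has_bochner_integral:
  fixes r s :: real
  assumes \<nu>: "\<nu> > 0" and r: "r + real \<nu> / 2 > 0" and s: "s < 1 / 2"
  shows "has_bochner_integral (chi_sq \<nu>) (\<lambda>y. y powr r * exp (s * y))
    (2 powr r * Gamma (r + real \<nu> / 2) / Gamma (real \<nu> / 2) * (1 - 2 * s) powr (- (r + real \<nu> / 2)))"
proof -
  define a where "a = r + real \<nu> / 2"
  define C where "C = 2 powr (real \<nu> / 2) * Gamma (real \<nu> / 2)"
  have C: "C > 0"
    using \<nu> by (simp add: C_def Gamma_real_pos)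
  have "has_bochner_integral lborel (\<lambda>x. inverse C * (if x > 0 then x powr (a - 1) * exp (- (1/2 - s) * x) else 0))
      (inverse C * (Gamma a / (1/2 - s) powr a))"
    using r s by (intro has_bochner_integral_mult_right gamma_density_has_bochner_integral) (auto simp: a_def)
  moreover have "inverse C * (if x > 0 then x powr (a - 1) * exp (- (1/2 - s) * x) else 0)
      = chi_sq_density \<nu> x *\<^sub>R (x powr r * exp (s * x))" for x
  proof (cases "x > 0")
    case True
    have "x powr (a - 1) = x powr (real \<nu> / 2 - 1) * x powr r"
      by (simp add: a_def algebra_simps flip: powr_add)
    moreover have "exp (- (1/2 - s) * x) = exp (- x / 2) * exp (s * x)"
      by (simp add: algebra_simps flip: exp_add)
    ultimately show ?thesis
      using True by (simp add: chi_sq_density_def C_def field_simps)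
  qed (simp add: chi_sq_density_def)
  moreover have "inverse C * (Gamma a / (1/2 - s) powr a)
      = 2 powr r * Gamma a / Gamma (real \<nu> / 2) * (1 - 2 * s) powr (- a)"
  proof -
    have "1/2 - s = (1 - 2 * s) / 2"
      by simp
    then have 1: "(1/2 - s) powr a = (1 - 2 * s) powr a / 2 powr a"
      using s by (simp only: powr_divide)
    have 2: "2 powr a = 2 powr r * 2 powr (real \<nu> / 2)"
      by (simp add: a_def powr_add)
    have "inverse (T * g) * (h / (y / (q * T))) = q * h / g * inverse y" if "T > 0" for T g h y q :: real
      using that by (simp add: field_simps)
    then show ?thesis
      unfolding C_def powr_minus 1 2 by simp
  qed
  ultimately have "has_bochner_integral lborel (\<lambda>x. chi_sq_density \<nu> x *\<^sub>R (x powr r * exp (s * x)))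
      (2 powr r * Gamma a / Gamma (real \<nu> / 2) * (1 - 2 * s) powr (- a))"
    by simp
  then show ?thesis
    unfolding chi_sq_def a_def
    using chi_sq_density_nonneg[OF \<nu>] by (intro has_bochner_integral_density) auto
qed

lemma AE_chi_sq_pos: "AE y in chi_sq \<nu>. y > 0"
  unfolding chi_sq_def by (subst AE_density) (auto simp: chi_sq_density_def)

lemma sets_chi_sq [measurable_cong, simp]: "sets (chi_sq \<nu>) = sets borel"
  by (simp add: chi_sq_def)

lemma chi_sq_exp_has_bochner_integral:
  assumes "\<nu> > 0" "s < 1 / 2"
  shows "has_bochner_integral (chi_sq \<nu>) (\<lambda>y. exp (s * y)) ((1 - 2 * s) powr (- (real \<nu> / 2)))"
proof -
  have "Gamma (real \<nu> / 2) > 0"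
    using assms by (simp add: Gamma_real_pos)
  then have "2 powr 0 * Gamma (0 + real \<nu> / 2) / Gamma (real \<nu> / 2) * (1 - 2 * s) powr (- (0 + real \<nu> / 2))
      = (1 - 2 * s) powr (- (real \<nu> / 2))"
    by simp
  then have "has_bochner_integral (chi_sq \<nu>) (\<lambda>y. y powr 0 * exp (s * y)) ((1 - 2 * s) powr (- (real \<nu> / 2)))"
    using chi_sq_has_bochner_integral[of \<nu> 0 s] assms by (simp only: add_0)
  \<comment> \<open>Only almost everywhere, since \<open>0 powr 0 = 0\<close>.\<close>
  moreover have "AE y in chi_sq \<nu>. y powr 0 * exp (s * y) = exp (s * y)"
    using AE_chi_sq_pos by eventually_elim simp
  ultimately show ?thesis
    by (subst (asm) has_bochner_integral_cong_AE) auto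
qed

text \<open>
  Writing \<open>f y = exp (s0 y) h (exp (- y))\<close> with \<open>h\<close> continuous on \<open>[0, 1]\<close> and \<open>h 0 = 0\<close>,
  polynomial approximation of \<open>h\<close> approximates \<open>f\<close> by combinations of exponentials, with an error
  of at most \<open>\<epsilon> exp (s0 y)\<close>.
\<close>

lemma expectation_limit_of_exp_limits:
  fixes W w :: "nat \<Rightarrow> 'a \<Rightarrow> real" and f :: "real \<Rightarrow> real"
  assumes w: "\<And>n x. x \<in> A n \<Longrightarrow> w n x \<ge> 0" and W: "\<And>n x. x \<in> A n \<Longrightarrow> W n x \<ge> 0"
    and M: "sets M = sets borel" "AE y in M. 0 \<le> y"
    and exp_int: "\<And>s. s < b \<Longrightarrow> integrable M (\<lambda>y. exp (s * y))"
    and exp_lim: "\<And>s. s < b \<Longrightarrow> (\<lambda>n. \<Sum>x\<in>A n. w n x * exp (s * W n x)) \<longlonglongrightarrow> (\<integral>y. exp (s * y) \<partial>M)"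
    and f: "f \<in> borel_measurable borel" "continuous_on {0..} f"
    and growth: "s0 < b" "((\<lambda>y. f y * exp (- s0 * y)) \<longlongrightarrow> 0) at_top"
  shows "integrable M f" and "(\<lambda>n. \<Sum>x\<in>A n. w n x * f (W n x)) \<longlonglongrightarrow> (\<integral>y. f y \<partial>M)"
proof -
  define h where "h u = (if u \<le> 0 then 0 else f (- ln u) * exp (s0 * ln u))" for u
  have h: "f y = exp (s0 * y) * h (exp (- y))" for y
    by (simp add: h_def flip: exp_add)
  have h_cont: "continuous_on {0..1} h"
    unfolding continuous_on_eq_continuous_within
  proof
    fix u :: real
    assume u: "u \<in> {0..1}"
    show "continuous (at u within {0..1}) h"
    proof (cases "u = 0")
      case True
      have "filterlim (\<lambda>u::real. - ln u) at_top (at_right 0)"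
        by real_asymp
      from filterlim_compose[OF growth(2) this]
      have "((\<lambda>u. f (- ln u) * exp (s0 * ln u)) \<longlongrightarrow> 0) (at_right 0)"
        by simp
      then have "(h \<longlongrightarrow> 0) (at_right 0)"
        by (rule Lim_transform_eventually) (auto simp: eventually_at_filter h_def)
      moreover have "at 0 within {0..1::real} = at_right 0"
        by (rule at_within_Icc_at_right) simp
      ultimately show ?thesis
        using True by (simp add: continuous_within h_def)
    next
      case False
      then have "u > 0" using u by simp
      have "continuous_on {0<..1} (\<lambda>u. f (- ln u) * exp (s0 * ln u))"
        by (intro continuous_intros continuous_on_compose2[OF f(2)]) (auto simp: ln_le_zero_iff)
      then have "continuous_on {0<..1} h"
        by (rule continuous_on_eq) (auto simp: h_def)
      then have "continuous (at u within {0<..1}) h"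
        using u \<open>u > 0\<close> by (simp add: continuous_on_eq_continuous_within)
      moreover have "at u within {0<..1} = at u within {0..1}"
        using \<open>u > 0\<close> by (intro at_within_nhd[of _ "{0<..}"]) auto
      ultimately show ?thesis
        by (simp add: continuous_within)
    qed
  qed
  have unit: "exp (- y) \<in> {0..1}" if "y \<ge> 0" for y :: real
    using that by simp
  obtain B where B: "\<And>u. u \<in> {0..1} \<Longrightarrow> \<bar>h u\<bar> \<le> B"
    using compact_imp_bounded[OF compact_continuous_image[OF h_cont compact_Icc]]
    unfolding bounded_iff by fastforce
  have f_meas: "f \<in> borel_measurable M"
    using f(1) measurable_cong_sets[OF M(1) refl] by blast
  show int_f: "integrable M f"
  proof (rule Bochner_Integration.integrable_bound[OF _ f_meas])
    show "integrable M (\<lambda>y. B * exp (s0 * y))"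
      using exp_int[OF growth(1)] by simp
    show "AE y in M. norm (f y) \<le> norm (B * exp (s0 * y))"
      using M(2)
    proof eventually_elim
      case (elim y)
      have "\<bar>h (exp (- y))\<bar> \<le> \<bar>B\<bar>"
        using B[OF unit[OF elim]] by linarith
      then show ?case
        by (simp add: h abs_mult mult.commute mult_left_mono)
    qed
  qed
  define m where "m = (\<integral>y. exp (s0 * y) \<partial>M)"
  have m: "m \<ge> 0" by (simp add: m_def)
  show "(\<lambda>n. \<Sum>x\<in>A n. w n x * f (W n x)) \<longlonglongrightarrow> (\<integral>y. f y \<partial>M)"
  proof (rule LIMSEQ_I)
    fix r :: real
    assume r: "r > 0"
    \<comment> \<open>The approximation error is at most \<open>\<epsilon> * m\<close> in the limit
      and eventually at most \<open>\<epsilon> * (m + 1)\<close> along the sequence; together these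
      stay below \<open>r / 2\<close>, leaving \<open>r / 2\<close> for the convergence of
      \<open>G\<close>.\<close>
    define \<epsilon> where "\<epsilon> = r / (4 * m + 4)"
    have \<epsilon>: "\<epsilon> > 0" using r m by (simp add: \<epsilon>_def)
    obtain g where g: "real_polynomial_function g" "\<And>u. u \<in> {0..1} \<Longrightarrow> \<bar>h u - g u\<bar> < \<epsilon>"
      using Stone_Weierstrass_real_polynomial_function[OF compact_Icc h_cont \<epsilon>] by blast
    obtain c N where c: "g = (\<lambda>u. \<Sum>i\<le>N. c i * u ^ i)"
      using g(1) real_polynomial_function_iff_sum by blast
    \<comment> \<open>The monomial \<open>u ^ i\<close> becomes an exponential with parameter
      \<open>s0 - i\<close>, which is below \<open>b\<close> but in general negative.\<close>
    define G where "G y = (\<Sum>i\<le>N. c i * exp ((s0 - real i) * y))" for y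
    have G: "G y = exp (s0 * y) * g (exp (- y))" for y
    proof -
      have "exp ((s0 - real i) * y) = exp (s0 * y) * exp (- y) ^ i" for i
        by (simp add: algebra_simps flip: exp_of_nat_mult exp_add)
      then show ?thesis
        by (simp add: G_def c sum_distrib_left mult.left_commute)
    qed
    have fG: "\<bar>f y - G y\<bar> \<le> \<epsilon> * exp (s0 * y)" if "y \<ge> 0" for y
    proof -
      have "\<bar>f y - G y\<bar> = exp (s0 * y) * \<bar>h (exp (- y)) - g (exp (- y))\<bar>"
        by (simp add: h G abs_mult flip: right_diff_distrib)
      also have "\<dots> \<le> exp (s0 * y) * \<epsilon>"
        using g(2)[OF unit[OF that]] by (intro mult_left_mono) auto
      finally show ?thesis by (simp add: mult.commute)
    qed
    have less_b: "s0 - real i < b" for i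
      using growth(1) by linarith
    have int_G: "integrable M G"
      unfolding G_def by (intro Bochner_Integration.integrable_sum integrable_mult_right exp_int less_b)
    have "(\<integral>y. G y \<partial>M) = (\<Sum>i\<le>N. c i * (\<integral>y. exp ((s0 - real i) * y) \<partial>M))"
      unfolding G_def by (simp add: integral_sum exp_int less_b)
    moreover have "(\<lambda>n. \<Sum>i\<le>N. c i * (\<Sum>x\<in>A n. w n x * exp ((s0 - real i) * W n x)))
        \<longlonglongrightarrow> (\<Sum>i\<le>N. c i * (\<integral>y. exp ((s0 - real i) * y) \<partial>M))"
      by (intro tendsto_sum tendsto_mult_left exp_lim less_b)
    moreover have "(\<Sum>i\<le>N. c i * (\<Sum>x\<in>A n. w n x * exp ((s0 - real i) * W n x)))
        = (\<Sum>x\<in>A n. w n x * G (W n x))" for n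
      by (simp add: G_def sum_distrib_left mult.left_commute) (rule sum.swap)
    ultimately have lim_G: "(\<lambda>n. \<Sum>x\<in>A n. w n x * G (W n x)) \<longlonglongrightarrow> (\<integral>y. G y \<partial>M)"
      by simp
    have "\<bar>(\<integral>y. f y \<partial>M) - (\<integral>y. G y \<partial>M)\<bar> = \<bar>\<integral>y. f y - G y \<partial>M\<bar>"
      by (simp add: Bochner_Integration.integral_diff[OF int_f int_G])
    also have "\<dots> \<le> (\<integral>y. \<bar>f y - G y\<bar> \<partial>M)"
      by (rule integral_abs_bound)
    also have "\<dots> \<le> (\<integral>y. \<epsilon> * exp (s0 * y) \<partial>M)"
    proof (rule integral_mono_AE)
      show "integrable M (\<lambda>y. \<bar>f y - G y\<bar>)"
        using int_f int_G by (intro integrable_abs Bochner_Integration.integrable_diff)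
      show "integrable M (\<lambda>y. \<epsilon> * exp (s0 * y))"
        using exp_int[OF growth(1)] by simp
      show "AE y in M. \<bar>f y - G y\<bar> \<le> \<epsilon> * exp (s0 * y)"
        using M(2) by eventually_elim (rule fG)
    qed
    finally have b1: "\<bar>(\<integral>y. f y \<partial>M) - (\<integral>y. G y \<partial>M)\<bar> \<le> \<epsilon> * m"
      by (simp add: m_def)
    have b2: "\<bar>(\<Sum>x\<in>A n. w n x * f (W n x)) - (\<Sum>x\<in>A n. w n x * G (W n x))\<bar>
        \<le> \<epsilon> * (\<Sum>x\<in>A n. w n x * exp (s0 * W n x))" for n
    proof -
      have "\<bar>(\<Sum>x\<in>A n. w n x * f (W n x)) - (\<Sum>x\<in>A n. w n x * G (W n x))\<bar>
          = \<bar>\<Sum>x\<in>A n. w n x * (f (W n x) - G (W n x))\<bar>"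
        by (simp add: right_diff_distrib sum_subtractf)
      also have "\<dots> \<le> (\<Sum>x\<in>A n. w n x * (\<epsilon> * exp (s0 * W n x)))"
        by (rule order_trans[OF sum_abs])
          (auto intro!: sum_mono mult_left_mono fG simp: abs_mult w W)
      finally show ?thesis
        by (simp add: sum_distrib_left mult.left_commute)
    qed
    have "eventually (\<lambda>n. (\<Sum>x\<in>A n. w n x * exp (s0 * W n x)) < m + 1) sequentially"
      using exp_lim[OF growth(1)] unfolding m_def by (rule order_tendstoD) simp
    moreover have "eventually (\<lambda>n. dist (\<Sum>x\<in>A n. w n x * G (W n x)) (\<integral>y. G y \<partial>M) < r / 2) sequentially"
      using lim_G r by (intro tendstoD) auto
    ultimately show "\<exists>n0. \<forall>n\<ge>n0. norm ((\<Sum>x\<in>A n. w n x * f (W n x)) - (\<integral>y. f y \<partial>M)) < r"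
      unfolding eventually_sequentially[symmetric]
    proof eventually_elim
      case (elim n)
      have "\<epsilon> * (\<Sum>x\<in>A n. w n x * exp (s0 * W n x)) \<le> \<epsilon> * (m + 1)"
        using elim(1) \<epsilon> by (intro mult_left_mono) auto
      moreover have "\<epsilon> * (m + 1) + \<epsilon> * m < r / 2"
      proof -
        have "\<epsilon> * (m + 1) + \<epsilon> * m < \<epsilon> * (2 * m + 2)"
          using \<epsilon> by (simp add: algebra_simps)
        also have "\<dots> = r / 2"
          using m by (simp add: \<epsilon>_def field_simps)
        finally show ?thesis .
      qed
      ultimately show ?case
        using b1 b2[of n] elim(2) unfolding dist_real_def real_norm_def by linarith
    qed
  qed
qed

section \<open>The limit theorem\<close>

text \<open>Both moment generating functions agree in the limit on the whole half-line
  \<open>s < 1 / 2\<close>, so the general criterion applies with \<open>b = 1 / 2\<close>.\<close>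

lemma mult_expect_limit:
  assumes k: "k \<ge> 2" and p: "\<And>i. i \<in> {1..k} \<Longrightarrow> p i > 0" "(\<Sum>i\<in>{1..k}. p i) = 1"
    and f: "f \<in> borel_measurable borel" "continuous_on {0..} f"
    and growth: "s0 < 1 / 2" "((\<lambda>y. f y * exp (- s0 * y)) \<longlongrightarrow> 0) at_top"
  shows "integrable (chi_sq (k - 1)) f"
    and "(\<lambda>n. mult_expect n k p (\<lambda>x. f (2 * real n * V_stat n k p x))) \<longlonglongrightarrow> chi_sq_expect (k - 1) f"
proof -
  have pos: "k - 1 > 0" using k by simp
  have w: "mult_pmf n k p x \<ge> 0" if "x \<in> mult_outcomes n k" for n x
    unfolding mult_pmf_def
    by (intro mult_nonneg_nonneg divide_nonneg_nonneg prod_nonneg ballI zero_le_power p(1)[THEN less_imp_le]) auto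
  have W: "2 * real n * V_stat n k p x \<ge> 0" if "x \<in> mult_outcomes n k" for n x
    using V_stat_nonneg[OF p that] by simp
  have exp_int: "integrable (chi_sq (k - 1)) (\<lambda>y. exp (s * y))" if "s < 1 / 2" for s
    using chi_sq_exp_has_bochner_integral[OF pos that] by (simp add: has_bochner_integral_iff)
  have exp_lim: "(\<lambda>n. \<Sum>x\<in>mult_outcomes n k. mult_pmf n k p x * exp (s * (2 * real n * V_stat n k p x)))
      \<longlonglongrightarrow> (\<integral>y. exp (s * y) \<partial>chi_sq (k - 1))" if "s < 1 / 2" for s
    using mult_expect_exp_limit[OF _ that p] k
      has_bochner_integral_integral_eq[OF chi_sq_exp_has_bochner_integral[OF pos that]]
    by (simp add: mult_expect_def)
  have AE: "AE y in chi_sq (k - 1). 0 \<le> y"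
    using AE_chi_sq_pos by eventually_elim simp
  note limit = expectation_limit_of_exp_limits[where A = "\<lambda>n. mult_outcomes n k" and w = "\<lambda>n. mult_pmf n k p"
      and W = "\<lambda>n x. 2 * real n * V_stat n k p x", OF w W sets_chi_sq AE exp_int exp_lim f growth]
  show "integrable (chi_sq (k - 1)) f"
    by (rule limit(1))
  show "(\<lambda>n. mult_expect n k p (\<lambda>x. f (2 * real n * V_stat n k p x))) \<longlonglongrightarrow> chi_sq_expect (k - 1) f"
    unfolding mult_expect_def chi_sq_expect_def by (rule limit(2))
qed

section \<open>Closed forms and the final assembly\<close>

lemma chi_sq_expect_powr:
  assumes "\<nu> > 0" "r + real \<nu> / 2 > 0"
  shows "chi_sq_expect \<nu> (\<lambda>y. y powr r) = 2 powr r * Gamma (r + real \<nu> / 2) / Gamma (real \<nu> / 2)"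
  using has_bochner_integral_integral_eq[OF chi_sq_has_bochner_integral[of \<nu> r 0]] assms
  by (simp add: chi_sq_expect_def)

lemma chi_sq_expect_id:
  assumes "\<nu> > 0"
  shows "chi_sq_expect \<nu> (\<lambda>y. y) = real \<nu>"
proof -
  have "chi_sq_expect \<nu> (\<lambda>y. y) = chi_sq_expect \<nu> (\<lambda>y. y powr 1)"
    unfolding chi_sq_expect_def
  proof (rule integral_cong_AE)
    show "AE y in chi_sq \<nu>. y = y powr 1"
      using AE_chi_sq_pos by eventually_elim simp
  qed auto
  also have "\<dots> = 2 * (Gamma (real \<nu> / 2 + 1) / Gamma (real \<nu> / 2))"
    using assms by (subst chi_sq_expect_powr) (auto simp: add.commute)
  also have "Gamma (real \<nu> / 2 + 1) = real \<nu> / 2 * Gamma (real \<nu> / 2)"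
    using assms by (intro Gamma_plus1) (auto elim!: nonpos_Ints_cases)
  also have "Gamma (real \<nu> / 2) > 0"
    using assms by (simp add: Gamma_real_pos)
  then have "2 * (real \<nu> / 2 * Gamma (real \<nu> / 2) / Gamma (real \<nu> / 2)) = real \<nu>"
    by simp
  finally show ?thesis .
qed

text \<open>Raw moments use \<open>powr\<close> with a real exponent. Central moments use natural
  exponents, because the centred variable takes negative values, for which a general real power has
  no meaning.\<close>

theorem theorem3p3:
  fixes k :: nat and p :: "nat \<Rightarrow> real"
  assumes "k \<ge> 2"
    and "\<forall>i\<in>{1..k}. p i \<ge> 0 \<and> p i \<noteq> 0"
    and "(\<Sum>i\<in>{1..k}. p i) = 1"
  shows
   "(\<forall>m::real. m \<ge> 1 \<longrightarrow>
      ((\<lambda>n. mult_expect n k p (\<lambda>x. (2 * real n * V_stat n k p x) powr m))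
          \<longlonglongrightarrow> chi_sq_expect (k - 1) (\<lambda>y. y powr m))
      \<and> chi_sq_expect (k - 1) (\<lambda>y. y powr m)
          = 2 powr m * Gamma (m + (real k - 1) / 2) / Gamma ((real k - 1) / 2))
    \<and> (\<forall>m::nat. m \<ge> 1 \<longrightarrow>
      (\<lambda>n. mult_expect n k p (\<lambda>x. (2 * real n * V_stat n k p x
              - mult_expect n k p (\<lambda>z. 2 * real n * V_stat n k p z)) ^ m))
          \<longlonglongrightarrow> chi_sq_expect (k - 1) (\<lambda>y. (y - chi_sq_expect (k - 1) (\<lambda>z. z)) ^ m))
    \<and> (\<forall>s::real. 0 \<le> s \<and> s < 1 / 2 \<longrightarrow>
      ((\<lambda>n. mult_expect n k p (\<lambda>x. exp (s * (2 * real n * V_stat n k p x))))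
          \<longlonglongrightarrow> chi_sq_expect (k - 1) (\<lambda>y. exp (s * y)))
      \<and> chi_sq_expect (k - 1) (\<lambda>y. exp (s * y)) = (1 - 2 * s) powr (- (real k - 1) / 2)
      \<and> ((\<lambda>n. mult_expect n k p (\<lambda>x. exp (s * (2 * real n * V_stat n k p x
              - mult_expect n k p (\<lambda>z. 2 * real n * V_stat n k p z)))))
          \<longlonglongrightarrow> chi_sq_expect (k - 1) (\<lambda>y. exp (s * (y - chi_sq_expect (k - 1) (\<lambda>z. z)))))
      \<and> chi_sq_expect (k - 1) (\<lambda>y. exp (s * (y - chi_sq_expect (k - 1) (\<lambda>z. z))))
          = exp (- (real k - 1) * s) * (1 - 2 * s) powr (- (real k - 1) / 2))"
proof -
  have p: "p i > 0" if "i \<in> {1..k}" for i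
    using assms(2) that by (simp add: less_le)
  have \<nu>: "k - 1 > 0" "real (k - 1) = real k - 1"
    using assms(1) by auto
  note limit = mult_expect_limit[OF assms(1) p assms(3)]
  define \<mu> where "\<mu> n = mult_expect n k p (\<lambda>z. 2 * real n * V_stat n k p z)" for n
  define c where "c = chi_sq_expect (k - 1) (\<lambda>z. z)"

  have moment_cont: "continuous_on {0..} (\<lambda>y::real. y ^ j)" for j
    by (intro continuous_intros)
  \<comment> \<open>\<open>1 / 4\<close> is an arbitrary choice of \<open>s0\<close> strictly
    between 0 and \<open>1 / 2\<close>.\<close>
  have moment_growth: "((\<lambda>y::real. y ^ j * exp (- (1 / 4) * y)) \<longlongrightarrow> 0) at_top" for j
    by real_asymp
  have moment_int: "integrable (chi_sq (k - 1)) (\<lambda>y. y ^ j)" for j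
    by (rule limit(1)[OF _ _ moment_cont _ moment_growth]) auto
  have moment_lim: "(\<lambda>n. mult_expect n k p (\<lambda>x. (2 * real n * V_stat n k p x) ^ j))
      \<longlonglongrightarrow> chi_sq_expect (k - 1) (\<lambda>y. y ^ j)" for j
    by (rule limit(2)[OF _ _ moment_cont _ moment_growth]) auto
  have mean_lim: "\<mu> \<longlonglongrightarrow> c"
    using moment_lim[of 1] by (simp add: \<mu>_def[abs_def] c_def)
  have c_eq: "c = real k - 1"
    using chi_sq_expect_id[OF \<nu>(1)] \<nu>(2) by (simp add: c_def)

  have powr_lim: "(\<lambda>n. mult_expect n k p (\<lambda>x. (2 * real n * V_stat n k p x) powr m))
      \<longlonglongrightarrow> chi_sq_expect (k - 1) (\<lambda>y. y powr m)" if "m \<ge> 1" for m :: real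
  proof (rule limit(2))
    \<comment> \<open>A positive exponent gives continuity at the endpoint, where
      \<open>0 powr m = 0\<close>.\<close>
    show "continuous_on {0..} (\<lambda>y. y powr m)"
      using that by (intro continuous_on_powr') auto
    show "((\<lambda>y. y powr m * exp (- (1 / 4) * y)) \<longlongrightarrow> 0) at_top"
      by real_asymp
  qed auto

  have central_lim: "(\<lambda>n. mult_expect n k p (\<lambda>x. (2 * real n * V_stat n k p x - \<mu> n) ^ m))
      \<longlonglongrightarrow> chi_sq_expect (k - 1) (\<lambda>y. (y - c) ^ m)" for m
  proof -
    \<comment> \<open>The centre \<open>\<mu> n\<close> moves with \<open>n\<close>, whereas the
      limit lemma treats a fixed function. The binomial expansion separates the powers of
      \<open>\<mu> n\<close>, which converge by \<open>mean_lim\<close>, from raw moments.\<close>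
    have expand: "(y - b) ^ m = (\<Sum>j\<le>m. real (m choose j) * (- b) ^ (m - j) * y ^ j)" for y b :: real
      using binomial_ring[of y "- b" m] by (simp add: mult_ac)
    have "mult_expect n k p (\<lambda>x. (2 * real n * V_stat n k p x - \<mu> n) ^ m)
        = (\<Sum>j\<le>m. real (m choose j) * (- \<mu> n) ^ (m - j) * mult_expect n k p (\<lambda>x. (2 * real n * V_stat n k p x) ^ j))" for n
      unfolding expand mult_expect_def sum_distrib_left
      by (subst sum.swap) (simp add: mult_ac)
    moreover have "chi_sq_expect (k - 1) (\<lambda>y. (y - c) ^ m)
        = (\<Sum>j\<le>m. real (m choose j) * (- c) ^ (m - j) * chi_sq_expect (k - 1) (\<lambda>y. y ^ j))"
      unfolding expand chi_sq_expect_def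
      by (subst Bochner_Integration.integral_sum) (intro integrable_mult_right moment_int, simp)
    moreover have "(\<lambda>n. \<Sum>j\<le>m. real (m choose j) * (- \<mu> n) ^ (m - j) * mult_expect n k p (\<lambda>x. (2 * real n * V_stat n k p x) ^ j))
        \<longlonglongrightarrow> (\<Sum>j\<le>m. real (m choose j) * (- c) ^ (m - j) * chi_sq_expect (k - 1) (\<lambda>y. y ^ j))"
      by (intro tendsto_intros mean_lim moment_lim)
    ultimately show ?thesis by simp
  qed

  have exp_val: "chi_sq_expect (k - 1) (\<lambda>y. exp (s * y)) = (1 - 2 * s) powr (- (real k - 1) / 2)"
    and exp_lim: "(\<lambda>n. mult_expect n k p (\<lambda>x. exp (s * (2 * real n * V_stat n k p x))))
      \<longlonglongrightarrow> chi_sq_expect (k - 1) (\<lambda>y. exp (s * y))" if s: "s < 1 / 2" for s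
  proof -
    show *: "chi_sq_expect (k - 1) (\<lambda>y. exp (s * y)) = (1 - 2 * s) powr (- (real k - 1) / 2)"
      using has_bochner_integral_integral_eq[OF chi_sq_exp_has_bochner_integral[OF \<nu>(1) s]]
      by (simp only: chi_sq_expect_def \<nu>(2) minus_divide_left)
    have "(\<lambda>n. mult_expect n k p (\<lambda>x. exp (s * (2 * real n * V_stat n k p x))))
        \<longlonglongrightarrow> (1 - 2 * s) powr (- (real (k - 1) / 2))"
      using assms(1) by (intro mult_expect_exp_limit s p assms(3)) auto
    then show "(\<lambda>n. mult_expect n k p (\<lambda>x. exp (s * (2 * real n * V_stat n k p x))))
        \<longlonglongrightarrow> chi_sq_expect (k - 1) (\<lambda>y. exp (s * y))"
      by (simp only: * \<nu>(2) minus_divide_left)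
  qed

  \<comment> \<open>For exponentials the moving centre simply factors out.\<close>
  have shift: "exp (s * (y - b)) = exp (- (s * b)) * exp (s * y)" for s y b :: real
    by (simp add: algebra_simps flip: exp_add)
  have shift_chi: "chi_sq_expect (k - 1) (\<lambda>y. exp (s * (y - c))) = exp (- (s * c)) * chi_sq_expect (k - 1) (\<lambda>y. exp (s * y))" for s
    by (simp add: chi_sq_expect_def shift)
  have central_exp_lim: "(\<lambda>n. mult_expect n k p (\<lambda>x. exp (s * (2 * real n * V_stat n k p x - \<mu> n))))
      \<longlonglongrightarrow> chi_sq_expect (k - 1) (\<lambda>y. exp (s * (y - c)))" if s: "s < 1 / 2" for s
  proof -
    have "mult_expect n k p (\<lambda>x. exp (s * (2 * real n * V_stat n k p x - \<mu> n)))
        = exp (- (s * \<mu> n)) * mult_expect n k p (\<lambda>x. exp (s * (2 * real n * V_stat n k p x)))" for n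
      unfolding shift mult_expect_def sum_distrib_left by (simp only: mult.left_commute)
    then show ?thesis
      unfolding shift_chi by (simp only:) (intro tendsto_intros mean_lim exp_lim[OF s])
  qed
  have central_exp_val: "chi_sq_expect (k - 1) (\<lambda>y. exp (s * (y - c)))
      = exp (- (real k - 1) * s) * (1 - 2 * s) powr (- (real k - 1) / 2)" if s: "s < 1 / 2" for s
    unfolding shift_chi exp_val[OF s] by (simp add: c_eq algebra_simps)

  show ?thesis
    unfolding \<mu>_def[symmetric] c_def[symmetric]
    using powr_lim chi_sq_expect_powr[OF \<nu>(1)] central_lim exp_lim exp_val central_exp_lim central_exp_val
    by (auto simp: \<nu>(2)[symmetric])
qed

end
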